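(* Let $n\ge2$ and let $\kappa=(k_1,\dots,k_n)$ and $\lambda=(l_1,\dots,l_n)$ be multi-indexes of non-negative integers with $2\le l_i\le k_i$ for all $i=1,\dots,n$. Let $(\mathfrak m;\mathfrak e,\mathfrak f)$ be the graded nilpotent Lie algebra with two graded subalgebras associated with the skew Young tableau of $(\kappa,\lambda)$. Then the generalized Tanaka prolongation $\mathfrak g(\mathfrak m;\mathfrak e,\mathfrak f)$ is finite-dimensional.
   Context: Skew Young tableau of $(\kappa,\lambda)$: it has $n$ rows with $k_1,\dots,k_n$ boxes; the rows are initially left aligned and then the $i$-th row is shifted to the left by $l_i$ boxes. Columns are numbered from left to right, the left-most non-empty column being the first. Explicitly, with $L=\max_i l_i$, the boxes of row $i$ are $(i,j)$, $0\le j\le k_i-1$, and box $(i,j)$ lies in column $L-l_i+j+1$. The Lie algebra $\mathfrak m=\mathbb R X\oplus V$: $V$ is the vector space with one basis element $e_{i,j}$ per box; $\deg e_{i,j}=-(L-l_i+j+1)$ (degrees decrease by $1$ from left to right, starting from $-1$, with equal degrees in the same column); $\deg X=-1$; $V$ is abelian, and $[X,e_{i,j}]=e_{i,j+1}$ if box $(i,j)$ has a right neighbor $(i,j+1)$, and $[X,e_{i,j}]=0$ otherwise. The subalgebras: $\mathfrak e=\langle X\rangle$, and $\mathfrak f\subset V$ is spanned by the basis elements corresponding to all boxes in the left-most complete column (a column containing a box in each row) and all boxes in the columns to the left of it. Generalized Tanaka prolongation: for a negatively graded nilpotent Lie algebra $\mathfrak m$ and graded subalgebras $\mathfrak e,\mathfrak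 f\subset\mathfrak m$, $\mathfrak g=\mathfrak g(\mathfrak m;\mathfrak e,\mathfrak f)$ is the largest graded Lie algebra $\mathfrak g=\bigoplus_{i\in\mathbb Z}\mathfrak g_i$ such that (1) $\mathfrak g_i=\mathfrak m_i$ for all $i<0$; (2) for $u\in\mathfrak g_i$, $i\ge0$, $[u,\mathfrak m]=0$ implies $u=0$; (3) for all $u\in\mathfrak g_i$, $i\ge0$, $[u,\mathfrak e]\subset\mathfrak e+\sum_{j\ge0}\mathfrak g_j$ and $[u,\mathfrak f]\subset\mathfrak f+\sum_{j\ge0}\mathfrak g_j$. *)

theory Defs
  imports "HOL-Analysis.Analysis" "HOL-Analysis.Finite_Function_Topology"
begin

section \<open>Graded Lie algebras\<close>

text \<open>
  A \<open>\<int>\<close>-graded real Lie algebra inside a real vector space \<^typ>\<open>'a::real_vector\<close>: \<open>gr g i\<close> is the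
  component of degree \<open>i\<close>, and the algebra itself is the sum of all components. The bracket is a
  total function of which only the restriction to \<open>lie_carrier g\<close> matters.
\<close>

record 'a graded_lie =
  gr :: "int \<Rightarrow> 'a set"
  brk :: "'a \<Rightarrow> 'a \<Rightarrow> 'a"

definition lie_carrier :: "'a::real_vector graded_lie \<Rightarrow> 'a set" where
  "lie_carrier g = span (\<Union>i. gr g i)"

definition nonneg_part :: "'a::real_vector graded_lie \<Rightarrow> 'a set" where
  "nonneg_part g = span (\<Union>i\<in>{0..}. gr g i)"

definition graded_lie_algebra :: "'a::real_vector graded_lie \<Rightarrow> bool" where
  "graded_lie_algebra g \<longleftrightarrow>
     (\<forall>i. subspace (gr g i)) \<and>
     (\<forall>I x. finite I \<and> (\<forall>i\<in>I. x i \<in> gr g i) \<and> (\<Sum>i\<in>I. x i) = 0 \<longrightarrow> (\<forall>i\<in>I. x i = 0)) \<and>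
     (\<forall>i j. \<forall>x\<in>gr g i. \<forall>y\<in>gr g j. brk g x y \<in> gr g (i + j)) \<and>
     (\<forall>x\<in>lie_carrier g. \<forall>y\<in>lie_carrier g. \<forall>z\<in>lie_carrier g. \<forall>r.
        brk g (x + y) z = brk g x z + brk g y z \<and>
        brk g z (x + y) = brk g z x + brk g z y \<and>
        brk g (r *\<^sub>R x) z = r *\<^sub>R brk g x z \<and>
        brk g z (r *\<^sub>R x) = r *\<^sub>R brk g z x \<and>
        brk g x x = 0 \<and>
        brk g x (brk g y z) + brk g y (brk g z x) + brk g z (brk g x y) = 0)"

definition finite_dimensional :: "'a::real_vector graded_lie \<Rightarrow> bool" where
  "finite_dimensional g \<longleftrightarrow> (\<exists>B. finite B \<and> lie_carrier g = span B)"

definition graded_lie_hom ::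
    "'a::real_vector graded_lie \<Rightarrow> 'b::real_vector graded_lie \<Rightarrow> ('a \<Rightarrow> 'b) \<Rightarrow> bool" where
  "graded_lie_hom g h \<phi> \<longleftrightarrow>
     (\<forall>x\<in>lie_carrier g. \<forall>y\<in>lie_carrier g. \<forall>r.
        \<phi> (x + y) = \<phi> x + \<phi> y \<and> \<phi> (r *\<^sub>R x) = r *\<^sub>R \<phi> x \<and>
        \<phi> (brk g x y) = brk h (\<phi> x) (\<phi> y)) \<and>
     (\<forall>i. \<phi> ` gr g i \<subseteq> gr h i)"

definition graded_subalgebra :: "'a::real_vector graded_lie \<Rightarrow> 'a set \<Rightarrow> bool" where
  "graded_subalgebra g h \<longleftrightarrow>
     h \<subseteq> lie_carrier g \<and> h = span (\<Union>i. h \<inter> gr g i) \<and> (\<forall>x\<in>h. \<forall>y\<in>h. brk g x y \<in> h)"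

section \<open>Generalized Tanaka prolongation\<close>

text \<open>
  \<open>tanaka_extension m e f g \<iota>\<close>: the graded Lie algebra \<open>g\<close>, whose negative part is identified with
  the negatively graded Lie algebra \<open>m\<close> by means of \<open>\<iota>\<close>, satisfies the three conditions from the
  definition of the generalized prolongation of \<open>(m; e, f)\<close>, namely \<open>g\<^sub>i = m\<^sub>i\<close> for \<open>i < 0\<close>,
  non-degeneracy in non-negative degrees, and preservation of \<open>e\<close> and \<open>f\<close> modulo the
  non-negative part.
\<close>

definition tanaka_extension ::
    "'m::real_vector graded_lie \<Rightarrow> 'm set \<Rightarrow> 'm set \<Rightarrow> 'g::real_vector graded_lie \<Rightarrow> ('m \<Rightarrow> 'g) \<Rightarrow> bool"
  where
  "tanaka_extension m e f g \<iota> \<longleftrightarrow>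
     graded_lie_algebra g \<and>
     (graded_lie_hom m g \<iota> \<and> inj_on \<iota> (lie_carrier m) \<and> (\<forall>i<0. \<iota> ` gr m i = gr g i)) \<and>
     (\<forall>i\<ge>0. \<forall>u\<in>gr g i. (\<forall>x\<in>lie_carrier m. brk g u (\<iota> x) = 0) \<longrightarrow> u = 0) \<and>
     (\<forall>i\<ge>0. \<forall>u\<in>gr g i.
        (\<forall>x\<in>e. brk g u (\<iota> x) \<in> {\<iota> y + w | y w. y \<in> e \<and> w \<in> nonneg_part g}) \<and>
        (\<forall>x\<in>f. brk g u (\<iota> x) \<in> {\<iota> y + w | y w. y \<in> f \<and> w \<in> nonneg_part g}))"

text \<open>
  The generalized prolongation is the largest such \<open>g\<close>: every other one embeds into it over \<open>m\<close>.
  The algebras \<open>g'\<close> it is compared with live in the space \<^typ>\<open>nat \<Rightarrow>\<^sub>0 real\<close> of countably infinite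
  dimension. For finite-dimensional \<open>m\<close> this is no restriction: by non-degeneracy \<open>g'\<^sub>i\<close> embeds into
  the linear maps from \<open>m\<close> to \<open>\<Oplus>\<^sub>j\<^sub><\<^sub>i g'\<^sub>j\<close>, homogeneous of degree \<open>i\<close>, so by induction all \<open>g'\<^sub>i\<close> are
  finite-dimensional and \<open>g'\<close> has countable dimension.
\<close>

definition is_generalized_prolongation ::
    "'m::real_vector graded_lie \<Rightarrow> 'm set \<Rightarrow> 'm set \<Rightarrow> 'g::real_vector graded_lie \<Rightarrow> ('m \<Rightarrow> 'g) \<Rightarrow> bool"
  where
  "is_generalized_prolongation m e f g \<iota> \<longleftrightarrow>
     tanaka_extension m e f g \<iota> \<and>
     (\<forall>(g' :: (nat \<Rightarrow>\<^sub>0 real) graded_lie) \<iota>'. tanaka_extension m e f g' \<iota>' \<longrightarrow>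
        (\<exists>\<phi>. graded_lie_hom g' g \<phi> \<and> inj_on \<phi> (lie_carrier g') \<and>
             (\<forall>x\<in>lie_carrier m. \<phi> (\<iota>' x) = \<iota> x)))"

section \<open>Skew Young tableaux\<close>

text \<open>Rows are numbered \<open>1, \<dots>, n\<close>; the boxes of row \<open>i\<close> are \<open>(i, 0), \<dots>, (i, k i - 1)\<close>.\<close>

definition boxes :: "nat \<Rightarrow> (nat \<Rightarrow> nat) \<Rightarrow> (nat \<times> nat) set" where
  "boxes n k = {(i, j). i \<in> {1..n} \<and> j < k i}"

text \<open>The subtraction does not truncate for \<open>i \<in> {1..n}\<close>.\<close>

definition column :: "nat \<Rightarrow> (nat \<Rightarrow> nat) \<Rightarrow> nat \<times> nat \<Rightarrow> nat" where
  "column n l = (\<lambda>(i, j). Max (l ` {1..n}) - l i + j + 1)"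

definition complete_column :: "nat \<Rightarrow> (nat \<Rightarrow> nat) \<Rightarrow> (nat \<Rightarrow> nat) \<Rightarrow> nat \<Rightarrow> bool" where
  "complete_column n k l c \<longleftrightarrow> (\<forall>i\<in>{1..n}. \<exists>j. (i, j) \<in> boxes n k \<and> column n l (i, j) = c)"

definition leftmost_complete_column :: "nat \<Rightarrow> (nat \<Rightarrow> nat) \<Rightarrow> (nat \<Rightarrow> nat) \<Rightarrow> nat" where
  "leftmost_complete_column n k l = (LEAST c. complete_column n k l c)"

text \<open>
  The Lie algebra of the tableau is realised in the real vector space freely generated by symbols
  \<open>GX\<close> and \<open>GE i j\<close>, as the span of those that belong to the tableau.
\<close>

datatype gen = GX | GE nat nat

abbreviation bvec :: "gen \<Rightarrow> gen \<Rightarrow>\<^sub>0 real" where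
  "bvec b \<equiv> Poly_Mapping.single b 1"

definition gens :: "nat \<Rightarrow> (nat \<Rightarrow> nat) \<Rightarrow> gen set" where
  "gens n k = insert GX {GE i j | i j. (i, j) \<in> boxes n k}"

fun gen_deg :: "nat \<Rightarrow> (nat \<Rightarrow> nat) \<Rightarrow> gen \<Rightarrow> int" where
  "gen_deg n l GX = - 1"
| "gen_deg n l (GE i j) = - int (column n l (i, j))"

definition right_neighbor :: "nat \<Rightarrow> (nat \<Rightarrow> nat) \<Rightarrow> nat \<Rightarrow> nat \<Rightarrow> gen \<Rightarrow>\<^sub>0 real" where
  "right_neighbor n k i j = (if (i, j + 1) \<in> boxes n k then bvec (GE i (j + 1)) else 0)"

fun gen_brk :: "nat \<Rightarrow> (nat \<Rightarrow> nat) \<Rightarrow> gen \<Rightarrow> gen \<Rightarrow> gen \<Rightarrow>\<^sub>0 real" where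
  "gen_brk n k GX GX = 0"
| "gen_brk n k GX (GE i j) = right_neighbor n k i j"
| "gen_brk n k (GE i j) GX = - right_neighbor n k i j"
| "gen_brk n k (GE i j) (GE i' j') = 0"

definition tableau_algebra ::
    "nat \<Rightarrow> (nat \<Rightarrow> nat) \<Rightarrow> (nat \<Rightarrow> nat) \<Rightarrow> (gen \<Rightarrow>\<^sub>0 real) graded_lie" where
  "tableau_algebra n k l =
     \<lparr> gr = (\<lambda>d. span {bvec b | b. b \<in> gens n k \<and> gen_deg n l b = d}),
       brk = (\<lambda>u v. \<Sum>a\<in>Poly_Mapping.keys u. \<Sum>b\<in>Poly_Mapping.keys v.
                (Poly_Mapping.lookup u a * Poly_Mapping.lookup v b) *\<^sub>R gen_brk n k a b) \<rparr>"

definition tableau_e :: "(gen \<Rightarrow>\<^sub>0 real) set" where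
  "tableau_e = span {bvec GX}"

definition tableau_f :: "nat \<Rightarrow> (nat \<Rightarrow> nat) \<Rightarrow> (nat \<Rightarrow> nat) \<Rightarrow> (gen \<Rightarrow>\<^sub>0 real) set" where
  "tableau_f n k l =
     span {bvec (GE i j) | i j. (i, j) \<in> boxes n k \<and> column n l (i, j) \<le> leftmost_complete_column n k l}"

subsection \<open>The data of a tableau satisfy the standing assumptions\<close>

text \<open>Right shift on \<open>V\<close>, i.e. the adjoint action of \<open>X\<close>.\<close>

fun gen_shift :: "nat \<Rightarrow> (nat \<Rightarrow> nat) \<Rightarrow> gen \<Rightarrow> gen \<Rightarrow>\<^sub>0 real" where
  "gen_shift n k GX = 0"
| "gen_shift n k (GE i j) = right_neighbor n k i j"

definition shift :: "nat \<Rightarrow> (nat \<Rightarrow> nat) \<Rightarrow> (gen \<Rightarrow>\<^sub>0 real) \<Rightarrow> gen \<Rightarrow>\<^sub>0 real" where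
  "shift n k v = (\<Sum>b\<in>Poly_Mapping.keys v. Poly_Mapping.lookup v b *\<^sub>R gen_shift n k b)"

lemma lookup_scaleR_pm:
  fixes x :: "'a \<Rightarrow>\<^sub>0 real"
  shows "Poly_Mapping.lookup (r *\<^sub>R x) b = r * Poly_Mapping.lookup x b"
proof -
  have "{i. r * Poly_Mapping.lookup x i \<noteq> 0} \<subseteq> {i. Poly_Mapping.lookup x i \<noteq> 0}" by auto
  then have "finite {i. r * Poly_Mapping.lookup x i \<noteq> 0}" using finite_lookup finite_subset by blast
  then show ?thesis by (simp add: scaleR_poly_mapping_def)
qed

lemma lookup_sum_pm: "Poly_Mapping.lookup (\<Sum>i\<in>I. x i) b = (\<Sum>i\<in>I. Poly_Mapping.lookup (x i) b)"
  by (induction I rule: infinite_finite_induct) (auto simp: lookup_add)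

lemma sum_keys_superset:
  fixes u :: "'a \<Rightarrow>\<^sub>0 real" and F :: "'a \<Rightarrow> 'b::real_vector"
  assumes "finite S" "Poly_Mapping.keys u \<subseteq> S"
  shows "(\<Sum>a\<in>Poly_Mapping.keys u. Poly_Mapping.lookup u a *\<^sub>R F a) = (\<Sum>a\<in>S. Poly_Mapping.lookup u a *\<^sub>R F a)"
  by (rule sum.mono_neutral_left) (use assms in \<open>auto simp: in_keys_iff\<close>)

lemma pm_expand:
  fixes x :: "'a \<Rightarrow>\<^sub>0 real"
  shows "x = (\<Sum>b\<in>Poly_Mapping.keys x. Poly_Mapping.lookup x b *\<^sub>R Poly_Mapping.single b 1)"
proof (rule poly_mapping_eqI)
  fix c
  have "(\<Sum>b\<in>Poly_Mapping.keys x. Poly_Mapping.lookup x b * Poly_Mapping.lookup (Poly_Mapping.single b 1) c)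
     = (\<Sum>b\<in>Poly_Mapping.keys x. if b = c then Poly_Mapping.lookup x c else 0)"
    by (rule sum.cong) (auto simp: lookup_single when_def)
  also have "\<dots> = Poly_Mapping.lookup x c" by (auto simp: sum.delta' in_keys_iff)
  finally show "Poly_Mapping.lookup x c =
     Poly_Mapping.lookup (\<Sum>b\<in>Poly_Mapping.keys x. Poly_Mapping.lookup x b *\<^sub>R Poly_Mapping.single b 1) c"
    by (simp add: lookup_sum_pm lookup_scaleR_pm)
qed

lemma span_bvec: "span {bvec b | b. P b} = {x. \<forall>b. Poly_Mapping.lookup x b \<noteq> 0 \<longrightarrow> P b}"
proof (intro equalityI subsetI)
  fix x assume "x \<in> span {bvec b | b. P b}"
  then show "x \<in> {x. \<forall>b. Poly_Mapping.lookup x b \<noteq> 0 \<longrightarrow> P b}"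
  proof (induction rule: span_induct_alt)
    case (step c x y)
    then show ?case by (auto simp: lookup_add lookup_scaleR_pm lookup_single when_def split: if_splits)
  qed simp
next
  fix x :: "gen \<Rightarrow>\<^sub>0 real"
  assume "x \<in> {x. \<forall>b. Poly_Mapping.lookup x b \<noteq> 0 \<longrightarrow> P b}"
  then have "(\<Sum>b\<in>Poly_Mapping.keys x. Poly_Mapping.lookup x b *\<^sub>R bvec b) \<in> span {bvec b | b. P b}"
    by (intro span_sum span_scale span_base) (auto simp: in_keys_iff)
  then show "x \<in> span {bvec b | b. P b}" using pm_expand[of x] by simp
qed

lemma gr_tableau: "gr (tableau_algebra n k l) d =
    {x. \<forall>b. Poly_Mapping.lookup x b \<noteq> 0 \<longrightarrow> b \<in> gens n k \<and> gen_deg n l b = d}"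
  by (simp add: tableau_algebra_def span_bvec)

lemma carrier_tableau: "lie_carrier (tableau_algebra n k l) =
    {x. \<forall>b. Poly_Mapping.lookup x b \<noteq> 0 \<longrightarrow> b \<in> gens n k}"
proof -
  have "span (\<Union>d. gr (tableau_algebra n k l) d) = span {bvec b | b. b \<in> gens n k}"
  proof (rule subset_antisym)
    have "gr (tableau_algebra n k l) d \<subseteq> span {bvec b | b. b \<in> gens n k}" for d
      by (auto simp: gr_tableau span_bvec)
    then show "span (\<Union>d. gr (tableau_algebra n k l) d) \<subseteq> span {bvec b | b. b \<in> gens n k}"
      by (intro span_minimal) auto
    show "span {bvec b | b. b \<in> gens n k} \<subseteq> span (\<Union>d. gr (tableau_algebra n k l) d)"
      by (rule span_mono) (auto simp: gr_tableau lookup_single when_def)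
  qed
  then show ?thesis by (simp add: lie_carrier_def span_bvec)
qed

lemma shift_superset:
  assumes "finite S" "Poly_Mapping.keys v \<subseteq> S"
  shows "shift n k v = (\<Sum>b\<in>S. Poly_Mapping.lookup v b *\<^sub>R gen_shift n k b)"
  unfolding shift_def by (rule sum_keys_superset[OF assms])

lemma shift_add: "shift n k (u + v) = shift n k u + shift n k v"
proof -
  let ?S = "Poly_Mapping.keys u \<union> Poly_Mapping.keys v"
  have "Poly_Mapping.keys (u + v) \<subseteq> ?S" by (rule Poly_Mapping.keys_add)
  then show ?thesis
    by (simp add: shift_superset[of ?S] lookup_add scaleR_add_left sum.distrib)
qed

lemma shift_scaleR: "shift n k (r *\<^sub>R v) = r *\<^sub>R shift n k v"
proof -
  let ?S = "Poly_Mapping.keys v"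
  have "Poly_Mapping.keys (r *\<^sub>R v) \<subseteq> ?S" by (auto simp: in_keys_iff lookup_scaleR_pm)
  then show ?thesis
    by (simp add: shift_superset[of ?S] lookup_scaleR_pm scaleR_sum_right)
qed

lemma shift_linear: "linear (shift n k)"
  by (rule linearI) (simp_all add: shift_add shift_scaleR)

lemma lookup_gen_shift:
  "Poly_Mapping.lookup (gen_shift n k b) c \<noteq> 0 \<Longrightarrow>
     (\<exists>i j. b = GE i j \<and> c = GE i (j + 1) \<and> (i, j + 1) \<in> boxes n k)"
  by (cases b) (auto simp: right_neighbor_def lookup_single when_def split: if_splits)

lemma lookup_shift:
  assumes "Poly_Mapping.lookup (shift n k v) c \<noteq> 0"
  shows "\<exists>i j. Poly_Mapping.lookup v (GE i j) \<noteq> 0 \<and> c = GE i (j + 1) \<and> (i, j + 1) \<in> boxes n k"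
proof -
  have "(\<Sum>b\<in>Poly_Mapping.keys v. Poly_Mapping.lookup v b * Poly_Mapping.lookup (gen_shift n k b) c) \<noteq> 0"
    using assms by (simp add: shift_def lookup_sum_pm lookup_scaleR_pm)
  then obtain b where "b \<in> Poly_Mapping.keys v"
      "Poly_Mapping.lookup v b * Poly_Mapping.lookup (gen_shift n k b) c \<noteq> 0"
    by (rule sum.not_neutral_contains_not_neutral)
  then have v: "Poly_Mapping.lookup v b \<noteq> 0" and "Poly_Mapping.lookup (gen_shift n k b) c \<noteq> 0"
    by simp_all
  from lookup_gen_shift[OF this(2)] v show ?thesis by blast
qed

lemma lookup_shift_GX [simp]: "Poly_Mapping.lookup (shift n k v) GX = 0"
  using lookup_shift[of n k v GX] by auto

lemma brk_tableau: "brk (tableau_algebra n k l) u v =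
    Poly_Mapping.lookup u GX *\<^sub>R shift n k v - Poly_Mapping.lookup v GX *\<^sub>R shift n k u"
proof -
  let ?U = "insert GX (Poly_Mapping.keys u)" and ?V = "insert GX (Poly_Mapping.keys v)"
  let ?u = "Poly_Mapping.lookup u" and ?v = "Poly_Mapping.lookup v"
  have gb: "gen_brk n k a b =
      (if a = GX then gen_shift n k b else 0) - (if b = GX then gen_shift n k a else 0)" for a b
    by (cases a; cases b) auto
  have su: "shift n k u = (\<Sum>b\<in>?U. ?u b *\<^sub>R gen_shift n k b)"
    and sv: "shift n k v = (\<Sum>b\<in>?V. ?v b *\<^sub>R gen_shift n k b)"
    by (rule shift_superset; auto)+
  have "brk (tableau_algebra n k l) u v =
      (\<Sum>a\<in>Poly_Mapping.keys u. ?u a *\<^sub>R (\<Sum>b\<in>Poly_Mapping.keys v. ?v b *\<^sub>R gen_brk n k a b))"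
    by (simp add: tableau_algebra_def scaleR_sum_right)
  also have "\<dots> = (\<Sum>a\<in>?U. ?u a *\<^sub>R (\<Sum>b\<in>Poly_Mapping.keys v. ?v b *\<^sub>R gen_brk n k a b))"
    by (rule sum_keys_superset) auto
  also have "\<dots> = (\<Sum>a\<in>?U. ?u a *\<^sub>R (\<Sum>b\<in>?V. ?v b *\<^sub>R gen_brk n k a b))"
  proof -
    have "(\<Sum>b\<in>Poly_Mapping.keys v. ?v b *\<^sub>R F b) = (\<Sum>b\<in>?V. ?v b *\<^sub>R F b)"
      for F :: "gen \<Rightarrow> gen \<Rightarrow>\<^sub>0 real"
      by (rule sum_keys_superset) auto
    then show ?thesis by (simp only:)
  qed
  also have "\<dots> = (\<Sum>a\<in>?U. \<Sum>b\<in>?V. if a = GX then (?u GX * ?v b) *\<^sub>R gen_shift n k b else 0)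
      - (\<Sum>a\<in>?U. \<Sum>b\<in>?V. if b = GX then (?v GX * ?u a) *\<^sub>R gen_shift n k a else 0)"
    unfolding sum_subtractf[symmetric] scaleR_sum_right
    by (intro sum.cong refl) (auto simp: gb scaleR_diff_right mult.commute)
  also have "(\<Sum>a\<in>?U. \<Sum>b\<in>?V. if a = GX then (?u GX * ?v b) *\<^sub>R gen_shift n k b else 0)
      = (\<Sum>b\<in>?V. \<Sum>a\<in>?U. if a = GX then (?u GX * ?v b) *\<^sub>R gen_shift n k b else 0)"
    by (rule sum.swap)
  also have "\<dots> = ?u GX *\<^sub>R shift n k v"
    by (subst sum.delta)
      (simp_all only: sv scaleR_sum_right scaleR_scaleR finite_insert finite_keys insertI1 if_True)
  also have "(\<Sum>a\<in>?U. \<Sum>b\<in>?V. if b = GX then (?v GX * ?u a) *\<^sub>R gen_shift n k a else 0)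
      = ?v GX *\<^sub>R shift n k u"
    by (subst sum.delta)
      (simp_all only: su scaleR_sum_right scaleR_scaleR finite_insert finite_keys insertI1 if_True)
  finally show ?thesis .
qed

theorem graded_lie_algebra_tableau: "graded_lie_algebra (tableau_algebra n k l)"
proof -
  let ?m = "tableau_algebra n k l"
  have "subspace (gr ?m d)" for d
    by (simp add: tableau_algebra_def)
  moreover have "x i = 0" if I: "finite I" "\<forall>i\<in>I. x i \<in> gr ?m i" "(\<Sum>i\<in>I. x i) = 0" "i \<in> I" for I x i
  proof (rule poly_mapping_eqI)
    fix b
    show "Poly_Mapping.lookup (x i) b = Poly_Mapping.lookup 0 b"
    proof (rule ccontr)
      assume nz: "Poly_Mapping.lookup (x i) b \<noteq> Poly_Mapping.lookup 0 b"
      then have "gen_deg n l b = i" using I by (auto simp: gr_tableau)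
      then have "Poly_Mapping.lookup (x j) b = 0" if "j \<in> I" "j \<noteq> i" for j
        using that I by (auto simp: gr_tableau)
      then have "(\<Sum>j\<in>I. Poly_Mapping.lookup (x j) b) = Poly_Mapping.lookup (x i) b"
        using I by (subst sum.remove[of I i]) auto
      then show False using I(3) nz by (metis lookup_sum_pm)
    qed
  qed
  moreover have "brk ?m x y \<in> gr ?m (i + j)" if xy: "x \<in> gr ?m i" "y \<in> gr ?m j" for x y i j
  proof -
    have *: "Poly_Mapping.lookup u GX *\<^sub>R shift n k v \<in> gr ?m (c + d)"
      if "u \<in> gr ?m c" "v \<in> gr ?m d" for u v c d
    proof (cases "Poly_Mapping.lookup u GX = 0")
      case False
      then have c: "c = -1" using that by (auto simp: gr_tableau)
      have "shift n k v \<in> gr ?m (c + d)"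
        unfolding gr_tableau c
        using that(2) by (auto dest!: lookup_shift simp: gr_tableau gens_def column_def)
      then show ?thesis by (auto simp: gr_tableau lookup_scaleR_pm)
    qed (simp add: gr_tableau)
    show ?thesis
      unfolding brk_tableau
      using *[OF xy] *[OF xy(2,1)] \<open>subspace (gr ?m (i + j))\<close> by (simp add: add.commute subspace_diff)
  qed
  ultimately show ?thesis
    unfolding graded_lie_algebra_def
    by (auto simp: brk_tableau lookup_add lookup_minus lookup_scaleR_pm algebra_simps
        linear_diff[OF shift_linear] shift_add shift_scaleR)
qed

lemma tableau_negatively_graded: "d \<ge> 0 \<Longrightarrow> gr (tableau_algebra n k l) d = {0}"
proof -
  assume d: "d \<ge> 0"
  have "gen_deg n l b < 0" for b by (cases b) (auto simp: column_def)
  with d have "gen_deg n l b \<noteq> d" for b by (metis not_le)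
  then have "x \<in> gr (tableau_algebra n k l) d \<longleftrightarrow> x = 0" for x
    by (auto simp: gr_tableau intro!: poly_mapping_eqI)
  then show ?thesis by auto
qed

lemma graded_subalgebra_tableauI:
  assumes "\<And>b. P b \<Longrightarrow> b \<in> gens n k" "h = span {bvec b | b. P b}"
    and "\<And>u v. u \<in> h \<Longrightarrow> v \<in> h \<Longrightarrow> brk (tableau_algebra n k l) u v = 0"
  shows "graded_subalgebra (tableau_algebra n k l) h"
proof -
  have 1: "h \<subseteq> span (\<Union>i. h \<inter> gr (tableau_algebra n k l) i)"
    unfolding assms(2)
  proof (rule span_mono, safe)
    fix b assume "P b"
    then show "bvec b \<in> (\<Union>i. span {bvec b |b. P b} \<inter> gr (tableau_algebra n k l) i)"
      using assms(1) by (auto simp: gr_tableau lookup_single when_def intro!: span_base)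
  qed
  have 2: "span (\<Union>i. h \<inter> gr (tableau_algebra n k l) i) \<subseteq> h"
    using assms(2) by (intro span_minimal) auto
  have 3: "h \<subseteq> lie_carrier (tableau_algebra n k l)"
    using assms(1) by (auto simp: assms(2) span_bvec carrier_tableau)
  have 4: "0 \<in> h" by (simp add: assms(2) span_zero)
  show ?thesis
    unfolding graded_subalgebra_def
  proof (intro conjI ballI)
    show "brk (tableau_algebra n k l) u v \<in> h" if "u \<in> h" "v \<in> h" for u v
      using assms(3)[OF that] 4 by (rule ssubst)
  qed (rule 3, rule subset_antisym[OF 1 2])
qed

theorem graded_subalgebra_tableau_e: "graded_subalgebra (tableau_algebra n k l) tableau_e"
proof (rule graded_subalgebra_tableauI[where P = "\<lambda>b. b = GX"])
  fix u v assume "u \<in> tableau_e" "v \<in> tableau_e"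
  moreover have "shift n k (bvec GX) = 0" by (simp add: shift_def)
  then have "shift n k w = 0" if "w \<in> tableau_e" for w
    using that unfolding tableau_e_def span_singleton by (elim rangeE) (simp only: shift_scaleR scaleR_zero_right)
  ultimately show "brk (tableau_algebra n k l) u v = 0"
    by (simp add: brk_tableau)
next
  show "tableau_e = span {bvec b | b. b = GX}" unfolding tableau_e_def by simp
qed (simp add: gens_def)

theorem graded_subalgebra_tableau_f: "graded_subalgebra (tableau_algebra n k l) (tableau_f n k l)"
proof -
  define P where "P b \<longleftrightarrow> (\<exists>i j. b = GE i j \<and> (i, j) \<in> boxes n k \<and>
    column n l (i, j) \<le> leftmost_complete_column n k l)" for b
  have f: "tableau_f n k l = span {bvec b | b. P b}"
    unfolding tableau_f_def P_def by (rule arg_cong[of _ _ span]) blast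
  show ?thesis
  proof (rule graded_subalgebra_tableauI[OF _ f])
    fix u v assume "u \<in> tableau_f n k l" "v \<in> tableau_f n k l"
    then have "Poly_Mapping.lookup u GX = 0" "Poly_Mapping.lookup v GX = 0"
      by (auto simp: f span_bvec P_def)
    then show "brk (tableau_algebra n k l) u v = 0" by (simp add: brk_tableau)
  next
    show "b \<in> gens n k" if "P b" for b using that unfolding P_def gens_def by blast
  qed
qed

text \<open>A complete column exists, so the minimum defining \<open>leftmost_complete_column\<close> is attained.\<close>

lemma complete_column_leftmost:
  assumes "\<And>i. i \<in> {1..n} \<Longrightarrow> 1 \<le> l i \<and> l i \<le> k i"
  shows "complete_column n k l (leftmost_complete_column n k l)"
proof -
  have "complete_column n k l (Max (l ` {1..n}))"
    unfolding complete_column_def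
  proof
    fix i assume i: "i \<in> {1..n}"
    define L where "L = Max (l ` {1..n})"
    have "l i \<le> L" using i by (auto simp: L_def)
    have "(i, l i - 1) \<in> boxes n k" using assms[OF i] i by (auto simp: boxes_def)
    moreover have "column n l (i, l i - 1) = L"
      using assms[OF i] \<open>l i \<le> L\<close> unfolding column_def split L_def[symmetric] by linarith
    ultimately show "\<exists>j. (i, j) \<in> boxes n k \<and> column n l (i, j) = Max (l ` {1..n})"
      unfolding L_def by blast
  qed
  then show ?thesis unfolding leftmost_complete_column_def by (rule LeastI[where P = "complete_column n k l"])
qed

end

theory Submission
  imports Defs
begin

text \<open>
  Let \<open>P\<close> be the sum of \<open>e\<close> and the non-negative part of \<open>g\<close>; it is stable under \<open>ad X\<close>. The
  operators \<open>ad v\<close>, \<open>v \<in> V\<close>, commute, and the operators in the algebra generated by them that map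
  \<open>g\<close> into \<open>P\<close> form an ideal stable under the derivation \<open>[ad X, -]\<close>; in characteristic \<open>0\<close> its
  radical is stable as well. For the first box \<open>a\<close> of a row, \<open>a \<in> f\<close> gives
  \<open>(ad a)\<^sup>2 g \<subseteq> f + g\<^sub>\<ge>\<^sub>0\<close>, so for large \<open>m\<close> the elements of \<open>(ad a)\<^sup>m g\<close> stay in \<open>f + g\<^sub>\<ge>\<^sub>0\<close>
  under all relevant powers of \<open>ad X\<close>. As every row ends to the right of the columns in \<open>f\<close> (this
  uses \<open>l\<^sub>i \<ge> 2\<close>), they lie in \<open>P\<close>. So \<open>a\<close> is in the radical, hence all of \<open>V\<close> is, and every long
  enough product of operators \<open>ad v\<close> maps \<open>g\<close> into \<open>P\<close>.

  If \<open>u\<close> has large degree, then short products do so, too, for reasons of degree. The elements that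
  all products of operators \<open>ad v\<close> map into \<open>P\<close> form a submodule for the action of \<open>m\<close>, and by
  non-degeneracy it contains no non-zero homogeneous element. So \<open>g\<^sub>i = 0\<close> for large \<open>i\<close>, and each
  \<open>g\<^sub>i\<close> is finite-dimensional by induction on \<open>i\<close>.
\<close>

section \<open>Spans and finite dimension\<close>

text \<open>Terms from the same subspace are merged, so that each index carries a single summand;
  this is the form to which independence of the components of a grading applies.\<close>

lemma span_UN_subspaces_sum:
  fixes S :: "'i \<Rightarrow> 'a::real_vector set"
  assumes "\<And>i. i \<in> J \<Longrightarrow> subspace (S i)" "z \<in> span (\<Union>i\<in>J. S i)"
  obtains I x where "finite I" "I \<subseteq> J" "\<And>i. i \<in> I \<Longrightarrow> x i \<in> S i" "z = (\<Sum>i\<in>I. x i)"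
proof -
  have "\<exists>I x. finite I \<and> I \<subseteq> J \<and> (\<forall>i\<in>I. x i \<in> S i) \<and> z = (\<Sum>i\<in>I. x i)"
    using assms(2)
  proof (induction rule: span_induct_alt)
    case base
    show ?case by (rule exI[of _ "{}"]) simp
  next
    case (step c y z)
    then obtain i I x where i: "i \<in> J" "y \<in> S i"
      and I: "finite I" "I \<subseteq> J" "\<forall>i\<in>I. x i \<in> S i" "z = (\<Sum>i\<in>I. x i)"
      by blast
    define x' where "x' = x(i := (if i \<in> I then x i else 0) + c *\<^sub>R y)"
    have z: "z = (if i \<in> I then x i else 0) + sum x (I - {i})"
      using I by (auto simp: sum.remove)
    have "sum x' (insert i I) = x' i + sum x' (I - {i})"
      using I(1) by (subst insert_Diff_single[symmetric], subst sum.insert) auto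
    also have "sum x' (I - {i}) = sum x (I - {i})"
      by (rule sum.cong) (auto simp: x'_def)
    also have "x' i + sum x (I - {i}) = c *\<^sub>R y + z"
      using z by (simp add: x'_def)
    finally have s: "c *\<^sub>R y + z = sum x' (insert i I)" by simp
    have "(if i \<in> I then x i else 0) \<in> S i"
      using I(3) i(1) assms(1)[of i] by (simp add: subspace_0)
    then have "x' i \<in> S i"
      using i assms(1)[of i] by (simp add: x'_def subspace_add subspace_scale)
    then have "\<forall>j\<in>insert i I. x' j \<in> S j"
      using I(3) by (auto simp: x'_def)
    then show ?case
      using s I(1,2) i(1) by (intro exI[of _ "insert i I"] exI[of _ x']) auto
  qed
  then show ?thesis using that by blast
qed

text \<open>Rank-nullity for a map that is linear on \<open>S\<close> only, as brackets are on the
  carrier: generators of the kernel together with preimages of a basis of the image generate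
  \<open>S\<close>.\<close>

lemma finite_span_ker_image:
  fixes S :: "'a::real_vector set" and \<phi> :: "'a \<Rightarrow> 'b::real_vector"
  assumes S: "subspace S"
    and add: "\<And>x y. x \<in> S \<Longrightarrow> y \<in> S \<Longrightarrow> \<phi> (x + y) = \<phi> x + \<phi> y"
    and scale: "\<And>r x. x \<in> S \<Longrightarrow> \<phi> (r *\<^sub>R x) = r *\<^sub>R \<phi> x"
    and ker: "finite A" "{x \<in> S. \<phi> x = 0} = span A"
    and im: "finite B" "\<phi> ` S \<subseteq> span B"
  shows "\<exists>G. finite G \<and> S = span G"
proof -
  \<comment> \<open>Vectors of \<open>B\<close> need not have preimages; a basis chosen inside the
    image has them, and it is finite because it is independent inside \<open>span B\<close>.\<close>
  obtain B' where B': "B' \<subseteq> \<phi> ` S" "independent B'" "\<phi> ` S \<subseteq> span B'"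
    using maximal_independent_subset by blast
  have fin: "finite B'"
    using independent_span_bound[OF im(1) B'(2)] B'(1) im(2) by blast
  obtain h where h: "\<And>b. b \<in> B' \<Longrightarrow> h b \<in> S \<and> \<phi> (h b) = b"
  proof -
    have "\<forall>b\<in>B'. \<exists>x. x \<in> S \<and> \<phi> x = b" using B'(1) by blast
    from bchoice[OF this] show ?thesis using that by blast
  qed
  have A: "A \<subseteq> S" using ker(2) span_superset[of A] by blast
  have zero: "\<phi> 0 = 0" using scale[of 0 0] S by (simp add: subspace_0)
  have sub: "span (A \<union> h ` B') \<subseteq> S"
    using A h S by (intro span_minimal) auto
  have hc: "(\<Sum>b\<in>T. c b *\<^sub>R h b) \<in> S \<and> \<phi> (\<Sum>b\<in>T. c b *\<^sub>R h b) = (\<Sum>b\<in>T. c b *\<^sub>R b)"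
    if "finite T" "T \<subseteq> B'" for c T
    using that
    by (induction T) (use h S zero in \<open>auto simp: add scale subspace_0 subspace_add subspace_scale\<close>)
  have "x \<in> span (A \<union> h ` B')" if x: "x \<in> S" for x
  proof -
    have "\<phi> x \<in> span B'" using x B'(3) by blast
    then obtain c where c: "\<phi> x = (\<Sum>b\<in>B'. c b *\<^sub>R b)"
      using fin by (auto simp: span_finite)
    define y where "y = (\<Sum>b\<in>B'. c b *\<^sub>R h b)"
    have y: "y \<in> S" "\<phi> y = \<phi> x" using hc[OF fin order_refl, of c] c by (simp_all add: y_def)
    have "\<phi> (x + (-1) *\<^sub>R y) = \<phi> x + \<phi> ((-1) *\<^sub>R y)"
      by (rule add[OF x subspace_scale[OF S y(1)]])
    also have "\<phi> ((-1) *\<^sub>R y) = (-1) *\<^sub>R \<phi> y" by (rule scale[OF y(1)])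
    finally have "\<phi> (x - y) = 0" using y(2) by simp
    then have "x - y \<in> span A"
      unfolding ker(2)[symmetric] using subspace_diff[OF S x y(1)] by blast
    then have "x - y \<in> span (A \<union> h ` B')"
      by (meson Un_upper1 span_mono subsetD)
    moreover have "y \<in> span (A \<union> h ` B')"
      unfolding y_def by (intro span_sum span_scale span_base) auto
    ultimately have "x - y + y \<in> span (A \<union> h ` B')" by (rule span_add)
    then show ?thesis by simp
  qed
  then show ?thesis
    using sub fin ker(1) by (intro exI[of _ "A \<union> h ` B'"]) auto
qed

text \<open>Induction on the number of maps: on the kernel of one map the others are still jointly
  injective, so this kernel is finitely generated and \<open>finite_span_ker_image\<close>
  applies.\<close>

lemma finite_span_if_jointly_injective:
  fixes S :: "'a::real_vector set" and \<phi> :: "'i \<Rightarrow> 'a \<Rightarrow> 'b::real_vector"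
  assumes "finite I" and S: "subspace S"
    and "\<And>i x y. i \<in> I \<Longrightarrow> x \<in> S \<Longrightarrow> y \<in> S \<Longrightarrow> \<phi> i (x + y) = \<phi> i x + \<phi> i y"
    and "\<And>i r x. i \<in> I \<Longrightarrow> x \<in> S \<Longrightarrow> \<phi> i (r *\<^sub>R x) = r *\<^sub>R \<phi> i x"
    and "\<And>i. i \<in> I \<Longrightarrow> \<exists>B. finite B \<and> \<phi> i ` S \<subseteq> span B"
    and "\<And>x. x \<in> S \<Longrightarrow> (\<And>i. i \<in> I \<Longrightarrow> \<phi> i x = 0) \<Longrightarrow> x = 0"
  shows "\<exists>G. finite G \<and> S = span G"
  using assms
proof (induction I arbitrary: S rule: finite_induct)
  case empty
  then have "S = span {}" using subspace_0 by auto
  then show ?case by blast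
next
  case (insert i I)
  let ?K = "{x \<in> S. \<phi> i x = 0}"
  have "\<phi> i 0 = 0" using insert.prems(3)[of i 0 0] insert.prems(1) by (simp add: subspace_0)
  then have "subspace ?K"
    using insert.prems(1-3) by (auto simp: subspace_def)
  then have "\<exists>G. finite G \<and> ?K = span G"
  proof (rule insert.IH)
    fix j assume "j \<in> I"
    then obtain B where "finite B" "\<phi> j ` S \<subseteq> span B" using insert.prems(4)[of j] by auto
    then show "\<exists>B. finite B \<and> \<phi> j ` ?K \<subseteq> span B" by blast
  next
    fix x assume "x \<in> ?K" "\<And>j. j \<in> I \<Longrightarrow> \<phi> j x = 0"
    then show "x = 0" using insert.prems(5)[of x] by blast
  qed (use insert.prems(2,3) in auto)
  then obtain A where A: "finite A" "?K = span A" by blast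
  obtain B where B: "finite B" "\<phi> i ` S \<subseteq> span B" using insert.prems(4)[of i] by auto
  show ?case
    by (rule finite_span_ker_image[OF insert.prems(1) _ _ A B]) (use insert.prems(2,3) in auto)
qed

section \<open>Graded Lie algebras\<close>

locale graded_lie_alg =
  fixes g :: "'a::real_vector graded_lie"
  assumes gla: "graded_lie_algebra g"
begin

abbreviation "C \<equiv> lie_carrier g"
abbreviation "ad \<equiv> brk g"

lemma subspace_gr: "subspace (gr g i)"
  using gla by (simp add: graded_lie_algebra_def)

lemma subspace_C: "subspace C"
  by (simp add: lie_carrier_def)

lemma gr_C: "x \<in> gr g i \<Longrightarrow> x \<in> C"
  by (auto simp: lie_carrier_def intro: span_base)

lemma brk_gr: "x \<in> gr g i \<Longrightarrow> y \<in> gr g j \<Longrightarrow> ad x y \<in> gr g (i + j)"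
  using gla by (simp add: graded_lie_algebra_def)

lemma gr_independent:
  "finite I \<Longrightarrow> (\<And>i. i \<in> I \<Longrightarrow> x i \<in> gr g i) \<Longrightarrow> (\<Sum>i\<in>I. x i) = 0 \<Longrightarrow> i \<in> I \<Longrightarrow> x i = 0"
  using gla unfolding graded_lie_algebra_def by blast

lemma
  assumes "x \<in> C" "y \<in> C" "z \<in> C"
  shows brk_add_left: "ad (x + y) z = ad x z + ad y z"
    and brk_add_right: "ad z (x + y) = ad z x + ad z y"
    and jacobi: "ad x (ad y z) + ad y (ad z x) + ad z (ad x y) = 0"
  using gla assms unfolding graded_lie_algebra_def by blast+

lemma
  assumes "x \<in> C" "z \<in> C"
  shows brk_scale_left: "ad (r *\<^sub>R x) z = r *\<^sub>R ad x z"
    and brk_scale_right: "ad z (r *\<^sub>R x) = r *\<^sub>R ad z x"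
    and brk_self: "ad x x = 0"
  using gla assms unfolding graded_lie_algebra_def by blast+

lemma brk_zero_right [simp]: "z \<in> C \<Longrightarrow> ad z 0 = 0"
  using brk_scale_right[of 0 z 0] subspace_0[OF subspace_C] by simp

lemma brk_zero_left [simp]: "z \<in> C \<Longrightarrow> ad 0 z = 0"
  using brk_scale_left[of 0 z 0] subspace_0[OF subspace_C] by simp

lemma brk_swap:
  assumes "x \<in> C" "y \<in> C" shows "ad x y = - ad y x"
proof -
  have xy: "x + y \<in> C" using assms subspace_C by (simp add: subspace_add)
  have "0 = ad (x + y) (x + y)" using xy by (simp add: brk_self)
  also have "\<dots> = ad x x + ad y x + (ad x y + ad y y)"
    using assms xy by (simp add: brk_add_left brk_add_right)
  finally have "ad x y + ad y x = 0" using assms by (simp add: brk_self add.commute)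
  then show ?thesis by (simp add: eq_neg_iff_add_eq_0)
qed

text \<open>The bracket is linear only on the carrier, so the span induction carries membership in
  \<open>C\<close> along.\<close>

lemma brk_span_right:
  assumes "a \<in> C" "A \<subseteq> C" "subspace T" "\<And>x. x \<in> A \<Longrightarrow> ad a x \<in> T" "x \<in> span A"
  shows "ad a x \<in> T"
proof -
  have "x \<in> C \<and> ad a x \<in> T" using assms(5)
  proof (induction rule: span_induct_alt)
    case base
    show ?case using assms(1,3) subspace_C by (simp add: subspace_0)
  next
    case (step c x y)
    then have "x \<in> C" using assms(2) by blast
    with step assms subspace_C show ?case
      by (auto simp: brk_add_right brk_scale_right subspace_add subspace_scale)
  qed
  then show ?thesis ..
qed

lemma brk_C: "x \<in> C \<Longrightarrow> y \<in> C \<Longrightarrow> ad x y \<in> C"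
proof -
  have C: "C = span (\<Union>i. gr g i)" by (simp add: lie_carrier_def)
  have U: "(\<Union>i. gr g i) \<subseteq> C" using gr_C by blast
  have 1: "ad y x \<in> C" if y: "y \<in> gr g i" and x: "x \<in> C" for x y i
  proof (rule brk_span_right[OF gr_C[OF y] U subspace_C])
    show "x \<in> span (\<Union>i. gr g i)" using x C by simp
  qed (use y brk_gr gr_C in blast)
  assume x: "x \<in> C" and y: "y \<in> C"
  show "ad x y \<in> C"
  proof (rule brk_span_right[OF x U subspace_C])
    show "y \<in> span (\<Union>i. gr g i)" using y C by simp
    fix z assume "z \<in> (\<Union>i. gr g i)"
    then obtain i where z: "z \<in> gr g i" by blast
    have "ad x z = - ad z x" using brk_swap x gr_C[OF z] by blast
    then show "ad x z \<in> C" using 1[OF z x] subspace_C by (simp add: subspace_neg)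
  qed
qed

lemma brk_derivation:
  assumes "x \<in> C" "y \<in> C" "z \<in> C"
  shows "ad x (ad y z) = ad (ad x y) z + ad y (ad x z)"
proof -
  have "ad y (ad z x) = - ad y (ad x z)"
    using brk_swap[of z x] brk_scale_right[of "ad x z" y "-1"] assms brk_C by simp
  moreover have "ad z (ad x y) = - ad (ad x y) z"
    using brk_swap assms brk_C by blast
  ultimately show ?thesis using jacobi[OF assms] by (simp add: algebra_simps)
qed

lemma brk_commute:
  assumes "a \<in> C" "b \<in> C" "ad a b = 0" "u \<in> C"
  shows "ad a (ad b u) = ad b (ad a u)"
  using brk_derivation[of a b u] assms by simp

section \<open>Powers of adjoint operators and their derivatives\<close>

lemma pow_C: "a \<in> C \<Longrightarrow> u \<in> C \<Longrightarrow> (ad a ^^ m) u \<in> C"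
  by (induction m) (auto intro: brk_C)

lemma pow_commute:
  assumes "a \<in> C" "b \<in> C" "ad a b = 0" "u \<in> C"
  shows "ad b ((ad a ^^ m) u) = (ad a ^^ m) (ad b u)"
proof (induction m)
  case (Suc m)
  have "ad b ((ad a ^^ Suc m) u) = ad a (ad b ((ad a ^^ m) u))"
    using brk_commute[OF assms(1-3), of "(ad a ^^ m) u"] assms pow_C by simp
  then show ?case using Suc by simp
qed simp

lemma pow_add:
  assumes "a \<in> C" "u \<in> C" "v \<in> C"
  shows "(ad a ^^ m) (u + v) = (ad a ^^ m) u + (ad a ^^ m) v"
  using assms by (induction m) (auto simp: pow_C brk_add_right)

lemma pow_scale:
  assumes "a \<in> C" "u \<in> C"
  shows "(ad a ^^ m) (r *\<^sub>R u) = r *\<^sub>R (ad a ^^ m) u"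
  using assms by (induction m) (auto simp: pow_C brk_scale_right)

text \<open>Product rule for the derivation \<open>[ad x, -]\<close> on a power of
  \<open>ad a\<close>: as \<open>ad x a\<close> commutes with \<open>a\<close>, the
  \<open>m + 1\<close> terms coincide. Writing the exponent as \<open>Suc m\<close> avoids a
  truncated \<open>m - 1\<close>.\<close>

lemma brk_pow:
  assumes "x \<in> C" "a \<in> C" "ad a (ad x a) = 0" "u \<in> C"
  shows "ad x ((ad a ^^ Suc m) u) =
    (ad a ^^ Suc m) (ad x u) + real (Suc m) *\<^sub>R (ad a ^^ m) (ad (ad x a) u)"
proof (induction m)
  case 0
  then show ?case using brk_derivation[of x a u] assms by (simp add: add.commute)
next
  case (Suc m)
  let ?b = "ad x a"
  have b: "?b \<in> C" using assms brk_C by blast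
  have "ad x ((ad a ^^ Suc (Suc m)) u) = ad x (ad a ((ad a ^^ Suc m) u))" by simp
  also have "\<dots> = ad ?b ((ad a ^^ Suc m) u) + ad a (ad x ((ad a ^^ Suc m) u))"
    by (rule brk_derivation[OF assms(1,2) pow_C[OF assms(2,4)]])
  also have "ad ?b ((ad a ^^ Suc m) u) = (ad a ^^ Suc m) (ad ?b u)"
    using assms b by (intro pow_commute) auto
  also have "ad a (ad x ((ad a ^^ Suc m) u)) =
      ad a ((ad a ^^ Suc m) (ad x u)) + real (Suc m) *\<^sub>R ad a ((ad a ^^ m) (ad ?b u))"
  proof -
    have "(ad a ^^ Suc m) (ad x u) \<in> C" "(ad a ^^ m) (ad ?b u) \<in> C"
      using assms b by (blast intro: pow_C brk_C)+
    then show ?thesis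
      unfolding Suc using assms(2) subspace_scale[OF subspace_C]
      by (subst brk_add_right) (auto simp: brk_scale_right simp del: funpow.simps of_nat_Suc)
  qed
  finally show ?case by (simp add: algebra_simps scaleR_2)
qed

text \<open>
  The exponents come from differentiating \<open>a\<^sup>m b\<^sup>q\<close> and multiplying by
  \<open>b = ad x a\<close>, which gives \<open>a\<^sup>m\<^sup>-\<^sup>1 b\<^sup>q\<^sup>+\<^sup>2\<close> modulo the ideal.
\<close>

lemma pow_in_derivation:
  assumes x: "x \<in> C" and a: "a \<in> C"
    and comm: "ad a (ad x a) = 0" "ad a (ad x (ad x a)) = 0" "ad (ad x a) (ad x (ad x a)) = 0"
    and P: "subspace P" "\<And>u. u \<in> P \<Longrightarrow> ad x u \<in> P"
    and pow: "\<And>u. u \<in> C \<Longrightarrow> (ad a ^^ m) u \<in> P"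
    and u: "u \<in> C"
  shows "(ad (ad x a) ^^ (2 * m)) u \<in> P"
proof -
  define b c where "b = ad x a" and "c = ad x b"
  have bc: "b \<in> C" "c \<in> C" using x a brk_C by (auto simp: b_def c_def)
  have "(ad a ^^ (m - j)) ((ad b ^^ (2 * j)) u) \<in> P" if "j \<le> m" "u \<in> C" for j u
    using that
  proof (induction j arbitrary: u)
    case 0
    then show ?case using pow by simp
  next
    case (Suc j)
    define i q where "i = m - Suc j" and "q = 2 * j"
    have i: "m - j = Suc i" using Suc.prems by (simp add: i_def)
    have IH: "(ad a ^^ Suc i) ((ad b ^^ q) v) \<in> P" if "v \<in> C" for v
      using Suc.IH[of v] Suc.prems that unfolding i q_def by simp
    let ?B = "(ad b ^^ Suc q) u"
    have bq: "(ad b ^^ Suc q) v = (ad b ^^ q) (ad b v)" for v by (simp only: funpow_Suc_right o_def)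
    have B: "?B \<in> C" using Suc.prems bc pow_C by blast
    \<comment> \<open>Both terms retain the factor \<open>(ad b)^q\<close>; the further factors
      \<open>ad b\<close> and \<open>ad c\<close> move into the argument, which the induction
      hypothesis leaves arbitrary.\<close>
    have "ad x ?B = (ad b ^^ Suc q) (ad x u) + real (Suc q) *\<^sub>R (ad b ^^ q) (ad c u)"
      unfolding c_def using comm x bc Suc.prems by (intro brk_pow) (auto simp: b_def)
    then have "(ad a ^^ Suc i) (ad x ?B) =
        (ad a ^^ Suc i) ((ad b ^^ Suc q) (ad x u)) + real (Suc q) *\<^sub>R (ad a ^^ Suc i) ((ad b ^^ q) (ad c u))"
      using x a bc Suc.prems
      by (simp add: pow_add pow_scale pow_C brk_C subspace_scale[OF subspace_C] del: funpow.simps of_nat_Suc)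
    also have "\<dots> \<in> P"
      unfolding bq using x bc Suc.prems P IH brk_C
      by (intro subspace_add subspace_scale) (auto simp del: funpow.simps)
    finally have 1: "(ad a ^^ Suc i) (ad x ?B) \<in> P" .
    \<comment> \<open>The product \<open>a^(i+1) b^(q+1)\<close> lies in the ideal, hence so does
      its derivative. Subtracting fact \<open>1\<close> isolates \<open>a^i b^(q+2)\<close>, whose
      coefficient is invertible in characteristic \<open>0\<close>.\<close>
    have "ad x ((ad a ^^ Suc i) ?B) \<in> P"
      unfolding bq using IH P brk_C bc Suc.prems by blast
    moreover have "ad x ((ad a ^^ Suc i) ?B) =
        (ad a ^^ Suc i) (ad x ?B) + real (Suc i) *\<^sub>R (ad a ^^ i) (ad b ?B)"
      unfolding b_def by (rule brk_pow[OF x a comm(1)]) (use B in \<open>simp add: b_def\<close>)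
    ultimately have "real (Suc i) *\<^sub>R (ad a ^^ i) (ad b ?B) \<in> P"
      using subspace_diff[OF P(1) _ 1] by (metis add_diff_cancel_left')
    then have "inverse (real (Suc i)) *\<^sub>R real (Suc i) *\<^sub>R (ad a ^^ i) (ad b ?B) \<in> P"
      using P(1) subspace_scale by blast
    then have "(ad a ^^ i) (ad b ?B) \<in> P" by simp
    then show ?case by (simp add: i_def q_def)
  qed
  from this[of m u] u show ?thesis by (simp add: b_def)
qed

text \<open>Each application of \<open>ad x\<close> uses up at most one factor \<open>ad a\<close>,
  so \<open>q\<close> of them leave \<open>m\<close> of the \<open>q + m\<close> factors in
  front.\<close>

lemma pow_image_brk:
  assumes "x \<in> C" "a \<in> C" "ad a (ad x a) = 0" "u \<in> C"
  shows "\<exists>v\<in>C. (ad x ^^ q) ((ad a ^^ (q + m)) u) = (ad a ^^ m) v"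
proof (induction q arbitrary: m)
  case 0
  show ?case using assms by auto
next
  case (Suc q)
  from Suc[of "Suc m"] obtain v where v: "v \<in> C"
    "(ad x ^^ q) ((ad a ^^ (q + Suc m)) u) = (ad a ^^ Suc m) v" by blast
  \<comment> \<open>The witness is what remains of the two terms of the product rule after
    \<open>m\<close> factors \<open>ad a\<close> have been taken out in front.\<close>
  let ?w = "ad a (ad x v) + real (Suc m) *\<^sub>R ad (ad x a) v"
  have "(ad x ^^ Suc q) ((ad a ^^ (Suc q + m)) u) = ad x ((ad a ^^ Suc m) v)"
    using v by simp
  also have "\<dots> = (ad a ^^ Suc m) (ad x v) + real (Suc m) *\<^sub>R (ad a ^^ m) (ad (ad x a) v)"
    by (rule brk_pow) (use assms v in auto)
  also have "\<dots> = (ad a ^^ m) ?w"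
    unfolding funpow_Suc_right o_def using assms v
    by (simp add: pow_add pow_scale brk_C subspace_scale[OF subspace_C] del: of_nat_Suc)
  finally show ?case
    using assms v by (intro bexI[of _ ?w]) (auto simp: brk_C subspace_add[OF subspace_C] subspace_scale[OF subspace_C])
qed

lemma nonneg_neg_disjoint:
  assumes "z \<in> nonneg_part g" "z \<in> span (\<Union>i\<in>{..<0}. gr g i)"
  shows "z = 0"
proof -
  obtain I x where I: "finite I" "I \<subseteq> {0..}" "\<And>i. i \<in> I \<Longrightarrow> x i \<in> gr g i" "z = sum x I"
    using span_UN_subspaces_sum[of "{0..}" "gr g" z] subspace_gr assms(1)
    unfolding nonneg_part_def by metis
  obtain J y where J: "finite J" "J \<subseteq> {..<0}" "\<And>i. i \<in> J \<Longrightarrow> y i \<in> gr g i" "z = sum y J"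
    using span_UN_subspaces_sum[of "{..<0}" "gr g" z] subspace_gr assms(2) by metis
  \<comment> \<open>The components of \<open>z\<close> and those of \<open>- z\<close> form one
    relation over disjoint index sets, so independence makes each of them vanish.\<close>
  define t where "t i = (if i \<in> I then x i else - y i)" for i
  have disj: "I \<inter> J = {}" using I(2) J(2) by force
  have "sum t (I \<union> J) = sum t I + sum t J"
    by (rule sum.union_disjoint[OF I(1) J(1) disj])
  also have "sum t I = z" unfolding I(4) by (rule sum.cong) (auto simp: t_def)
  also have "sum t J = - z"
    unfolding J(4) sum_negf[symmetric] using disj by (intro sum.cong) (auto simp: t_def)
  finally have "sum t (I \<union> J) = 0" by simp
  moreover have "t i \<in> gr g i" if "i \<in> I \<union> J" for i
    using that I(3) J(3) subspace_neg[OF subspace_gr] by (auto simp: t_def)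
  ultimately have "t i = 0" if "i \<in> I \<union> J" for i
    using gr_independent[of "I \<union> J" t i] I(1) J(1) that by blast
  then have "x i = 0" if "i \<in> I" for i using that by (force simp: t_def)
  then show ?thesis using I(4) by simp
qed

lemma pow_gr: "a \<in> gr g c \<Longrightarrow> u \<in> gr g d \<Longrightarrow> (ad a ^^ m) u \<in> gr g (int m * c + d)"
proof (induction m)
  case (Suc m)
  then show ?case using brk_gr[of a c "(ad a ^^ m) u" "int m * c + d"] by (simp add: algebra_simps)
qed simp

end

section \<open>The algebra of a tableau\<close>

lemma shift_bvec: "shift n k (bvec b) = gen_shift n k b"
  by (simp add: shift_def)

lemma brk_tableau_X: "brk (tableau_algebra n k l) (bvec GX) v = shift n k v"
  by (simp add: brk_tableau shift_bvec)

lemma lookup_shift_GE: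
  assumes "(i, Suc j) \<in> boxes n k"
  shows "Poly_Mapping.lookup (shift n k v) (GE i (Suc j)) = Poly_Mapping.lookup v (GE i j)"
proof -
  have *: "Poly_Mapping.lookup (gen_shift n k b) (GE i (Suc j)) = (if b = GE i j then 1 else 0)" for b
    using assms by (cases b) (auto simp: right_neighbor_def lookup_single when_def)
  have "Poly_Mapping.lookup (shift n k v) (GE i (Suc j)) =
      (\<Sum>b\<in>Poly_Mapping.keys v. if b = GE i j then Poly_Mapping.lookup v b else 0)"
    unfolding shift_def lookup_sum_pm lookup_scaleR_pm * by (rule sum.cong) auto
  also have "\<dots> = Poly_Mapping.lookup v (GE i j)"
    by (auto simp: in_keys_iff)
  finally show ?thesis .
qed

text \<open>Within a row nothing is lost or mixed: a coefficient travels unchanged up to the last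
  box.\<close>

lemma lookup_shift_pow:
  "j + q < k i \<Longrightarrow> i \<in> {1..n} \<Longrightarrow>
    Poly_Mapping.lookup ((shift n k ^^ q) v) (GE i (j + q)) = Poly_Mapping.lookup v (GE i j)"
  by (induction q) (auto simp: lookup_shift_GE boxes_def)

lemma shift_pow_carrier:
  "y \<in> lie_carrier (tableau_algebra n k l) \<Longrightarrow> (shift n k ^^ q) y \<in> lie_carrier (tableau_algebra n k l)"
  by (induction q) (auto simp: carrier_tableau gens_def dest!: lookup_shift)

lemma tableau_f_iff:
  "y \<in> tableau_f n k l \<longleftrightarrow> (\<forall>b. Poly_Mapping.lookup y b \<noteq> 0 \<longrightarrow>
     (\<exists>i j. b = GE i j \<and> (i, j) \<in> boxes n k \<and> column n l (i, j) \<le> leftmost_complete_column n k l))"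
proof -
  have "tableau_f n k l = span {bvec b | b. \<exists>i j. b = GE i j \<and> (i, j) \<in> boxes n k \<and>
      column n l (i, j) \<le> leftmost_complete_column n k l}"
    unfolding tableau_f_def by (rule arg_cong[of _ _ span]) blast
  then show ?thesis by (simp add: span_bvec)
qed

lemma finite_boxes: "finite (boxes n k)"
proof -
  have "boxes n k = (SIGMA i:{1..n}. {..<k i})" by (auto simp: boxes_def)
  then show ?thesis by simp
qed

lemma gens_eq: "gens n k = insert GX ((\<lambda>(i, j). GE i j) ` boxes n k)"
  by (auto simp: gens_def)

lemma finite_gens: "finite (gens n k)"
  by (simp add: gens_eq finite_boxes)

lemma bvec_gr: "b \<in> gens n k \<Longrightarrow> bvec b \<in> gr (tableau_algebra n k l) (gen_deg n l b)"
  by (auto simp: gr_tableau lookup_single when_def)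

lemma gr_carrier_tableau: "y \<in> gr (tableau_algebra n k l) d \<Longrightarrow> y \<in> lie_carrier (tableau_algebra n k l)"
  by (auto simp: gr_tableau carrier_tableau)

lemma gen_deg_neg: "gen_deg n l b < 0"
  by (cases b) (auto simp: column_def)

section \<open>Extensions of the algebra of a tableau\<close>

locale tableau_extension =
  fixes n :: nat and k l :: "nat \<Rightarrow> nat"
    and g :: "'g::real_vector graded_lie" and \<iota> :: "(gen \<Rightarrow>\<^sub>0 real) \<Rightarrow> 'g"
  assumes n: "1 \<le> n"
    and l: "\<And>i. i \<in> {1..n} \<Longrightarrow> 2 \<le> l i \<and> l i \<le> k i"
    and ext: "tanaka_extension (tableau_algebra n k l) tableau_e (tableau_f n k l) g \<iota>"

sublocale tableau_extension \<subseteq> graded_lie_alg g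
  by unfold_locales (use ext in \<open>simp add: tanaka_extension_def\<close>)

context tableau_extension
begin

abbreviation "T \<equiv> tableau_algebra n k l"
abbreviation "f \<equiv> tableau_f n k l"
abbreviation "X \<equiv> \<iota> (bvec GX)"
abbreviation "E b \<equiv> \<iota> (bvec (GE (fst b) (snd b)))"

section \<open>The embedding of the tableau algebra and the brackets of its basis\<close>

lemma
  shows hom: "graded_lie_hom T g \<iota>"
    and \<iota>_inj_on: "inj_on \<iota> (lie_carrier T)"
    and gr_neg: "d < 0 \<Longrightarrow> gr g d = \<iota> ` gr T d"
    and nondegenerate: "0 \<le> i \<Longrightarrow> u \<in> gr g i \<Longrightarrow> (\<And>x. x \<in> lie_carrier T \<Longrightarrow> ad u (\<iota> x) = 0) \<Longrightarrow> u = 0"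
    and brk_e: "0 \<le> i \<Longrightarrow> u \<in> gr g i \<Longrightarrow> x \<in> tableau_e \<Longrightarrow>
      ad u (\<iota> x) \<in> {\<iota> y + w | y w. y \<in> tableau_e \<and> w \<in> nonneg_part g}"
    and brk_f: "0 \<le> i \<Longrightarrow> u \<in> gr g i \<Longrightarrow> x \<in> f \<Longrightarrow>
      ad u (\<iota> x) \<in> {\<iota> y + w | y w. y \<in> f \<and> w \<in> nonneg_part g}"
  using ext unfolding tanaka_extension_def by simp_all

lemma
  assumes "x \<in> lie_carrier T" "y \<in> lie_carrier T"
  shows \<iota>_add: "\<iota> (x + y) = \<iota> x + \<iota> y"
    and \<iota>_brk: "\<iota> (brk T x y) = ad (\<iota> x) (\<iota> y)"
  using hom assms by (simp_all add: graded_lie_hom_def)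

lemma \<iota>_scale: "x \<in> lie_carrier T \<Longrightarrow> \<iota> (r *\<^sub>R x) = r *\<^sub>R \<iota> x"
  using hom by (simp add: graded_lie_hom_def)

lemma \<iota>_inj: "x \<in> lie_carrier T \<Longrightarrow> y \<in> lie_carrier T \<Longrightarrow> \<iota> x = \<iota> y \<Longrightarrow> x = y"
  using \<iota>_inj_on by (simp add: inj_on_def)

lemma \<iota>_gr: "x \<in> gr T d \<Longrightarrow> \<iota> x \<in> gr g d"
  using hom unfolding graded_lie_hom_def by blast

lemma subspace_carrier: "subspace (lie_carrier T)"
  by (simp add: lie_carrier_def)

lemma \<iota>_zero: "\<iota> 0 = 0"
  using \<iota>_scale[of 0 0] subspace_0[OF subspace_carrier] by simp

lemma \<iota>_diff: "x \<in> lie_carrier T \<Longrightarrow> y \<in> lie_carrier T \<Longrightarrow> \<iota> (x - y) = \<iota> x - \<iota> y"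
  using \<iota>_add[of "x - y" y] subspace_diff[OF subspace_carrier, of x y] by simp

lemma bvec_carrier: "b \<in> gens n k \<Longrightarrow> bvec b \<in> lie_carrier T"
  using bvec_gr gr_carrier_tableau by blast

lemma carrier_span: "lie_carrier T = span {bvec b | b. b \<in> gens n k}"
  by (simp add: carrier_tableau span_bvec)

lemma \<iota>_span:
  assumes "x \<in> lie_carrier T"
  shows "\<iota> x \<in> span ((\<lambda>b. \<iota> (bvec b)) ` gens n k)"
proof -
  have "x \<in> lie_carrier T \<and> \<iota> x \<in> span ((\<lambda>b. \<iota> (bvec b)) ` gens n k)"
    using assms unfolding carrier_span
  proof (induction rule: span_induct_alt)
    case base
    show ?case by (simp add: \<iota>_zero span_zero)
  next
    case (step c x y)
    then obtain b where b: "b \<in> gens n k" "x = bvec b" by blast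
    then have x: "x \<in> lie_carrier T" "c *\<^sub>R x \<in> lie_carrier T"
      using bvec_carrier subspace_scale[OF subspace_carrier] by blast+
    have y: "y \<in> lie_carrier T" using step by (simp add: carrier_span)
    have "\<iota> (c *\<^sub>R x + y) = c *\<^sub>R \<iota> x + \<iota> y" using x y by (simp add: \<iota>_add \<iota>_scale)
    moreover have "\<iota> x \<in> span ((\<lambda>b. \<iota> (bvec b)) ` gens n k)" using b by (auto intro: span_base)
    ultimately show ?case
      using step x y subspace_add[OF subspace_carrier]
      by (simp add: carrier_span[symmetric] span_add span_scale)
  qed
  then show ?thesis ..
qed

lemma gens_intros: "GX \<in> gens n k" "b \<in> boxes n k \<Longrightarrow> GE (fst b) (snd b) \<in> gens n k"
  by (auto simp: gens_def)

lemma X_gr: "X \<in> gr g (- 1)"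
  using \<iota>_gr[OF bvec_gr[OF gens_intros(1)]] by simp

lemma E_gr: "b \<in> boxes n k \<Longrightarrow> E b \<in> gr g (- int (column n l b))"
  using \<iota>_gr[OF bvec_gr[OF gens_intros(2)]] by simp

lemma X_C: "X \<in> C" and E_C: "b \<in> boxes n k \<Longrightarrow> E b \<in> C"
  using X_gr E_gr gr_C by blast+

lemma brk_X_E:
  assumes "b \<in> boxes n k"
  shows "ad X (E b) = (if (fst b, Suc (snd b)) \<in> boxes n k then E (fst b, Suc (snd b)) else 0)"
  using \<iota>_brk[OF bvec_carrier[OF gens_intros(1)] bvec_carrier[OF gens_intros(2)[OF assms]]]
  by (auto simp: brk_tableau_X shift_bvec right_neighbor_def \<iota>_zero split: if_splits)

lemma brk_E_E: "b \<in> boxes n k \<Longrightarrow> b' \<in> boxes n k \<Longrightarrow> ad (E b) (E b') = 0"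
  using \<iota>_brk[OF bvec_carrier[OF gens_intros(2)] bvec_carrier[OF gens_intros(2)], of b b']
  by (simp add: brk_tableau lookup_single when_def \<iota>_zero)

section \<open>The sum of \<open>e\<close> and the non-negative part\<close>

definition "P = span (insert X (\<Union>i\<in>{0..}. gr g i))"

lemma subspace_P: "subspace P"
  by (simp add: P_def)

lemma P_iff: "z \<in> P \<longleftrightarrow> (\<exists>c. z - c *\<^sub>R X \<in> nonneg_part g)"
  unfolding P_def nonneg_part_def span_insert by simp

lemma P_gr: "0 \<le> i \<Longrightarrow> u \<in> gr g i \<Longrightarrow> u \<in> P"
  unfolding P_def by (rule span_base) auto

text \<open>On non-negative degrees this is the defining condition on \<open>e\<close>;
  \<open>X\<close> itself commutes with \<open>X\<close>.\<close>

lemma brk_X_P: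
  assumes "u \<in> P" shows "ad X u \<in> P"
proof (rule brk_span_right[OF X_C _ subspace_P])
  show "u \<in> span (insert X (\<Union>i\<in>{0..}. gr g i))" using assms by (simp add: P_def)
  show "insert X (\<Union>i\<in>{0..}. gr g i) \<subseteq> C" using X_C gr_C by blast
  fix x assume "x \<in> insert X (\<Union>i\<in>{0..}. gr g i)"
  then consider "x = X" | i where "0 \<le> i" "x \<in> gr g i" by auto
  then show "ad X x \<in> P"
  proof cases
    case 1
    then show ?thesis using brk_self[OF X_C X_C] subspace_0[OF subspace_P] by simp
  next
    case 2
    have "bvec GX \<in> tableau_e" unfolding tableau_e_def by (rule span_base) simp
    from brk_e[OF 2 this] obtain y w where
      yw: "ad x X = \<iota> y + w" "y \<in> tableau_e" "w \<in> nonneg_part g" by blast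
    from yw(2) obtain c where "y = c *\<^sub>R bvec GX"
      by (auto simp: tableau_e_def span_singleton)
    then have "\<iota> y = c *\<^sub>R X" using \<iota>_scale bvec_carrier gens_intros(1) by blast
    then have "ad x X - c *\<^sub>R X \<in> nonneg_part g" using yw by simp
    then have "ad x X \<in> P" using P_iff by blast
    moreover have "ad X x = - ad x X" using brk_swap X_C gr_C[OF 2(2)] by blast
    ultimately show ?thesis using subspace_neg[OF subspace_P] by simp
  qed
qed

section \<open>The sum of \<open>f\<close> and the non-negative part\<close>

definition "Q = {\<iota> y + w | y w. y \<in> f \<and> w \<in> nonneg_part g}"

lemma f_carrier: "y \<in> f \<Longrightarrow> y \<in> lie_carrier T"
  using graded_subalgebra_tableau_f unfolding graded_subalgebra_def by blast

lemma subspace_f: "subspace f"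
  by (simp add: tableau_f_def)

lemma subspace_nonneg: "subspace (nonneg_part g)"
  by (simp add: nonneg_part_def)

lemma subspace_Q: "subspace Q"
  unfolding subspace_def
proof (intro conjI ballI allI)
  have "0 = \<iota> 0 + 0" by (simp add: \<iota>_zero)
  then show "0 \<in> Q" unfolding Q_def using subspace_0[OF subspace_f] subspace_0[OF subspace_nonneg] by blast
next
  fix x x' assume "x \<in> Q" "x' \<in> Q"
  then obtain y w y' w' where *: "x = \<iota> y + w" "x' = \<iota> y' + w'" "y \<in> f" "y' \<in> f"
    "w \<in> nonneg_part g" "w' \<in> nonneg_part g" unfolding Q_def by blast
  then have "x + x' = \<iota> (y + y') + (w + w')" by (simp add: \<iota>_add f_carrier)
  then show "x + x' \<in> Q" unfolding Q_def
    using * subspace_add[OF subspace_f] subspace_add[OF subspace_nonneg] by blast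
next
  fix c x assume "x \<in> Q"
  then obtain y w where *: "x = \<iota> y + w" "y \<in> f" "w \<in> nonneg_part g" unfolding Q_def by blast
  then have "c *\<^sub>R x = \<iota> (c *\<^sub>R y) + c *\<^sub>R w" by (simp add: \<iota>_scale f_carrier scaleR_add_right)
  then show "c *\<^sub>R x \<in> Q" unfolding Q_def
    using * subspace_scale[OF subspace_f] subspace_scale[OF subspace_nonneg] by blast
qed

lemma \<iota>_neg_part:
  assumes "y \<in> lie_carrier T" shows "\<iota> y \<in> span (\<Union>i\<in>{..<0}. gr g i)"
proof -
  have "(\<lambda>b. \<iota> (bvec b)) ` gens n k \<subseteq> (\<Union>i\<in>{..<0}. gr g i)"
    using \<iota>_gr bvec_gr gen_deg_neg by fast
  then show ?thesis using \<iota>_span[OF assms] span_mono by blast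
qed

text \<open>The grading is direct, so elements of the negative part that agree modulo the
  non-negative part are equal.\<close>

lemma \<iota>_in_Q:
  assumes "y \<in> lie_carrier T" "\<iota> y \<in> Q" shows "y \<in> f"
proof -
  from assms(2) obtain y' w where *: "\<iota> y = \<iota> y' + w" "y' \<in> f" "w \<in> nonneg_part g"
    unfolding Q_def by blast
  then have "w = \<iota> (y - y')" using assms(1) by (simp add: \<iota>_diff f_carrier)
  then have "w = 0"
    using nonneg_neg_disjoint[OF *(3)] \<iota>_neg_part subspace_diff[OF subspace_carrier assms(1) f_carrier[OF *(2)]]
    by simp
  then have "y = y'" using * assms(1) \<iota>_inj f_carrier by simp
  then show ?thesis using * by simp
qed

text \<open>The non-negative part is sent into \<open>Q\<close> by the defining condition on
  \<open>f\<close>, and \<open>f\<close> itself is killed because \<open>V\<close> is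
  abelian.\<close>

lemma brk_E_Q:
  assumes b: "b \<in> boxes n k" "bvec (GE (fst b) (snd b)) \<in> f" and q: "q \<in> Q"
  shows "ad (E b) q \<in> Q"
proof -
  have nonneg: "ad (E b) w \<in> Q" if "w \<in> nonneg_part g" for w
  proof (rule brk_span_right[OF E_C[OF b(1)] _ subspace_Q])
    show "w \<in> span (\<Union>i\<in>{0..}. gr g i)" using that by (simp add: nonneg_part_def)
    show "(\<Union>i\<in>{0..}. gr g i) \<subseteq> C" using gr_C by blast
    fix u assume "u \<in> (\<Union>i\<in>{0..}. gr g i)"
    then obtain i where u: "0 \<le> i" "u \<in> gr g i" by auto
    from brk_f[OF u b(2)] have "ad u (E b) \<in> Q" unfolding Q_def by blast
    moreover have "ad (E b) u = - ad u (E b)" using brk_swap E_C[OF b(1)] gr_C[OF u(2)] by blast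
    ultimately show "ad (E b) u \<in> Q" using subspace_neg[OF subspace_Q] by simp
  qed
  from q obtain y w where *: "q = \<iota> y + w" "y \<in> f" "w \<in> nonneg_part g" unfolding Q_def by blast
  have "Poly_Mapping.lookup y GX = 0" using *(2) unfolding tableau_f_iff by blast
  then have "ad (E b) (\<iota> y) = 0"
    using \<iota>_brk[OF bvec_carrier[OF gens_intros(2)[OF b(1)]] f_carrier[OF *(2)]]
    by (simp add: brk_tableau lookup_single when_def \<iota>_zero)
  moreover have "\<iota> y \<in> C" "w \<in> C"
    using \<iota>_neg_part[OF f_carrier[OF *(2)]] *(3) span_mono[of "\<Union>i\<in>_. gr g i" "\<Union>i. gr g i"]
    unfolding lie_carrier_def nonneg_part_def by blast+
  ultimately show ?thesis using nonneg[OF *(3)] E_C[OF b(1)] by (simp add: *(1) brk_add_right)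
qed

text \<open>In non-negative degrees the first application already lands in \<open>Q\<close>. In
  negative degrees it yields a multiple of the right neighbour of \<open>b\<close>, which may lie
  outside \<open>f\<close>, and the second application kills it.\<close>

lemma brk_E_E_Q:
  assumes b: "b \<in> boxes n k" "bvec (GE (fst b) (snd b)) \<in> f" and "u \<in> C"
  shows "ad (E b) (ad (E b) u) \<in> Q"
proof -
  let ?T = "{v \<in> C. ad (E b) v \<in> Q}"
  note E = E_C[OF b(1)]
  have "subspace ?T"
    unfolding subspace_def
    using subspace_C subspace_Q E
    by (auto simp: subspace_def brk_add_right brk_scale_right)
  have "ad (E b) u \<in> ?T"
  proof (rule brk_span_right[OF E _ \<open>subspace ?T\<close>])
    show "u \<in> span (\<Union>i. gr g i)" using assms(3) by (simp add: lie_carrier_def)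
    show "(\<Union>i. gr g i) \<subseteq> C" using gr_C by blast
    fix v assume "v \<in> (\<Union>i. gr g i)"
    then obtain i where v: "v \<in> gr g i" by blast
    have vC: "ad (E b) v \<in> C" using E gr_C[OF v] brk_C by blast
    have "ad (E b) (ad (E b) v) \<in> Q"
    proof (cases "0 \<le> i")
      case True
      from brk_f[OF True v b(2)] have "ad v (E b) \<in> Q" unfolding Q_def by blast
      moreover have "ad (E b) v = - ad v (E b)" using brk_swap E gr_C[OF v] by blast
      ultimately have "ad (E b) v \<in> Q" using subspace_neg[OF subspace_Q] by simp
      then show ?thesis by (rule brk_E_Q[OF b])
    next
      case False
      then obtain y where y: "y \<in> gr T i" "v = \<iota> y"
        using v gr_neg[of i] by auto
      note y = gr_carrier_tableau[OF y(1)] y(2)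
      let ?b = "GE (fst b) (snd b)"
      have s: "shift n k (bvec ?b) \<in> lie_carrier T"
        using shift_pow_carrier[OF bvec_carrier[OF gens_intros(2)[OF b(1)]], of 1] by simp
      \<comment> \<open>As \<open>V\<close> is abelian, only the coefficient of \<open>X\<close> in
        \<open>y\<close> contributes.\<close>
      have "ad (E b) v = \<iota> (- (Poly_Mapping.lookup y GX *\<^sub>R shift n k (bvec ?b)))"
        using \<iota>_brk[OF bvec_carrier[OF gens_intros(2)[OF b(1)]] y(1)] y(2)
        by (simp add: brk_tableau lookup_single when_def)
      also have "\<dots> = \<iota> ((- Poly_Mapping.lookup y GX) *\<^sub>R shift n k (bvec ?b))" by simp
      also have "\<dots> = (- Poly_Mapping.lookup y GX) *\<^sub>R \<iota> (shift n k (bvec ?b))"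
        by (rule \<iota>_scale[OF s])
      finally have "ad (E b) v = (- Poly_Mapping.lookup y GX) *\<^sub>R \<iota> (shift n k (bvec ?b))" .
      moreover have "ad (E b) (\<iota> (shift n k (bvec ?b))) = 0"
        using \<iota>_brk[OF bvec_carrier[OF gens_intros(2)[OF b(1)]] s]
        by (simp add: brk_tableau lookup_single when_def \<iota>_zero)
      moreover have "\<iota> (shift n k (bvec ?b)) \<in> C"
        using \<iota>_neg_part[OF s] span_mono[of "\<Union>i\<in>{..<0}. gr g i" "\<Union>i. gr g i"]
        unfolding lie_carrier_def by blast
      ultimately have "ad (E b) (ad (E b) v) = 0" using E by (simp add: brk_scale_right del: scaleR_minus_left)
      then show ?thesis using subspace_0[OF subspace_Q] by simp
    qed
    then show "ad (E b) v \<in> ?T" using vC by blast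
  qed
  then show ?thesis by blast
qed

section \<open>The columns of \<open>f\<close> and the ends of the rows\<close>

lemma l_le_Max: "i \<in> {1..n} \<Longrightarrow> l i \<le> Max (l ` {1..n})"
  by simp

text \<open>Let \<open>L\<close> be the maximum of the shifts. As \<open>l i\<close> is at least
  \<open>2\<close>, every row has a box \<open>l i - 2\<close>, and all these boxes lie in column
  \<open>L - 1\<close>, which is therefore complete.\<close>

lemma leftmost_complete_column_less: "leftmost_complete_column n k l < Max (l ` {1..n})"
proof -
  let ?L = "Max (l ` {1..n})"
  have "complete_column n k l (?L - 1)"
    unfolding complete_column_def
  proof
    fix i assume i: "i \<in> {1..n}"
    have "(i, l i - 2) \<in> boxes n k" using l[OF i] i by (auto simp: boxes_def)
    moreover have "column n l (i, l i - 2) = ?L - 1"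
      using l[OF i] l_le_Max[OF i] unfolding column_def split by linarith
    ultimately show "\<exists>j. (i, j) \<in> boxes n k \<and> column n l (i, j) = ?L - 1" by blast
  qed
  then have "leftmost_complete_column n k l \<le> ?L - 1"
    unfolding leftmost_complete_column_def by (rule Least_le)
  moreover have "?L \<ge> 2" using l_le_Max[of 1] l[of 1] n order_trans[of 2 "l 1" ?L] by simp
  ultimately show ?thesis by linarith
qed

lemma row_start_in_f:
  assumes "i \<in> {1..n}"
  shows "(i, 0) \<in> boxes n k" "bvec (GE i 0) \<in> f"
proof -
  show 1: "(i, 0) \<in> boxes n k" using l[OF assms] assms by (auto simp: boxes_def)
  have "complete_column n k l (leftmost_complete_column n k l)"
    by (rule complete_column_leftmost) (use l in force)
  then obtain j where "column n l (i, j) = leftmost_complete_column n k l"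
    unfolding complete_column_def using assms by blast
  then have "column n l (i, 0) \<le> leftmost_complete_column n k l" by (simp add: column_def)
  with 1 show "bvec (GE i 0) \<in> f" unfolding tableau_f_def by (intro span_base) blast
qed

text \<open>The last box of row \<open>i\<close> lies in column \<open>L - l i + k i\<close>, which
  is at least the maximal shift \<open>L\<close>.\<close>

lemma row_end_not_in_f:
  assumes "i \<in> {1..n}"
  shows "\<not> column n l (i, k i - 1) \<le> leftmost_complete_column n k l"
  using l[OF assms] l_le_Max[OF assms] leftmost_complete_column_less unfolding column_def split by linarith

section \<open>Nilpotency of the box operators modulo \<open>P\<close>\<close>

lemma pow_X_\<iota>: "y \<in> lie_carrier T \<Longrightarrow> (ad X ^^ q) (\<iota> y) = \<iota> ((shift n k ^^ q) y)"
proof (induction q)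
  case (Suc q)
  then show ?case
    using \<iota>_brk[OF bvec_carrier[OF gens_intros(1)] shift_pow_carrier[OF Suc.prems, of q]]
    by (simp add: brk_tableau_X)
qed simp

text \<open>A non-zero coefficient in row \<open>i\<close> would be pushed by at most
  \<open>k i - 1\<close> applications of \<open>ad X\<close> to the last box of the row, which is
  not in \<open>f\<close>.\<close>

lemma eq_zero_if_pow_X_in_Q:
  assumes y: "y \<in> lie_carrier T" and Q: "\<And>q. q \<le> N \<Longrightarrow> (ad X ^^ q) (\<iota> y) \<in> Q"
    and N: "\<And>i. i \<in> {1..n} \<Longrightarrow> k i \<le> N"
  shows "y = 0"
proof (rule poly_mapping_eqI)
  fix b
  have f: "(shift n k ^^ q) y \<in> f" if "q \<le> N" for q
    using Q[OF that] \<iota>_in_Q shift_pow_carrier[OF y] pow_X_\<iota>[OF y] by simp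
  show "Poly_Mapping.lookup y b = Poly_Mapping.lookup 0 b"
  proof (rule ccontr)
    assume nz: "Poly_Mapping.lookup y b \<noteq> Poly_Mapping.lookup 0 b"
    \<comment> \<open>Exponent \<open>0\<close> says that \<open>y\<close> itself lies in
      \<open>f\<close>, so \<open>X\<close> does not occur in it.\<close>
    with f[of 0] obtain i j where b: "b = GE i j" "(i, j) \<in> boxes n k"
      unfolding tableau_f_iff by auto
    then have ij: "i \<in> {1..n}" "j < k i" by (auto simp: boxes_def)
    define q where "q = k i - 1 - j"
    have q: "j + q = k i - 1" "j + q < k i" "q \<le> N" using ij N[OF ij(1)] by (auto simp: q_def)
    have "Poly_Mapping.lookup ((shift n k ^^ q) y) (GE i (k i - 1)) \<noteq> 0"
      using lookup_shift_pow[where v = y and j = j and q = q and k = k and n = n and i = i] q(2) ij(1) nz by (simp add: b(1) q(1))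
    then have "column n l (i, k i - 1) \<le> leftmost_complete_column n k l"
      using f[OF q(3)] unfolding tableau_f_iff by blast
    then show False using row_end_not_in_f[OF ij(1)] by blast
  qed
qed

text \<open>In negative degree the image is shown to vanish. Up to \<open>N\<close> applications of
  \<open>ad X\<close> cost at most as many factors \<open>ad a\<close>, and the two left over bring
  the outcome into \<open>Q\<close>; hence \<open>N + 2\<close>.\<close>

lemma row_start_pow_in_P:
  assumes i: "i \<in> {1..n}" and N: "\<And>i. i \<in> {1..n} \<Longrightarrow> k i \<le> N" and "u \<in> C"
  shows "(ad (E (i, 0)) ^^ (N + 2)) u \<in> P"
proof -
  let ?a = "E (i, 0)"
  note b = row_start_in_f[OF i]
  have a: "?a \<in> C" using E_C[OF b(1)] .
  have comm: "ad ?a (ad X ?a) = 0"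
    using brk_E_E[OF b(1)] a by (simp add: brk_X_E[OF b(1)] del: fst_conv snd_conv)
  \<comment> \<open>Homogeneous arguments come first: their images are homogeneous, so they have
    non-negative degree or lie in the image of \<open>\<iota>\<close>.\<close>
  have hom: "(ad ?a ^^ (N + 2)) v \<in> P" if v: "v \<in> gr g d" for v d
  proof -
    let ?z = "(ad ?a ^^ (N + 2)) v"
    have "\<exists>d. ?z \<in> gr g d" using pow_gr[OF E_gr[OF b(1)] v] by blast
    then obtain d' where d': "?z \<in> gr g d'" by blast
    show ?thesis
    proof (cases "0 \<le> d'")
      case True
      then show ?thesis using P_gr d' by blast
    next
      case False
      then obtain y where y: "y \<in> gr T d'" "?z = \<iota> y"
        using d' gr_neg[of d'] unfolding image_iff by fastforce
      note y = gr_carrier_tableau[OF y(1)] y(2)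
      have "(ad X ^^ q) (\<iota> y) \<in> Q" if q: "q \<le> N" for q
      proof -
        have s: "N + 2 = q + Suc (Suc (N - q))" using q by simp
        obtain w where w: "w \<in> C" "(ad X ^^ q) ?z = (ad ?a ^^ Suc (Suc (N - q))) w"
          using pow_image_brk[OF X_C a comm gr_C[OF v], of q "Suc (Suc (N - q))"] unfolding s by blast
        have "(ad ?a ^^ Suc (Suc (N - q))) w = ad ?a (ad ?a ((ad ?a ^^ (N - q)) w))" by simp
        also have "\<dots> \<in> Q" by (rule brk_E_E_Q) (use b a w pow_C in auto)
        finally show ?thesis using w y by simp
      qed
      then have "y = 0" using eq_zero_if_pow_X_in_Q[OF y(1) _ N] by blast
      then show ?thesis using y \<iota>_zero subspace_0[OF subspace_P] by simp
    qed
  qed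
  have "u \<in> C \<and> (ad ?a ^^ (N + 2)) u \<in> P"
    using assms(3) unfolding lie_carrier_def
  proof (induction rule: span_induct_alt)
    case base
    have "(ad ?a ^^ (N + 2)) 0 = 0" using pow_scale[OF a, of 0 "N + 2" 0] subspace_0[OF subspace_C] by simp
    then show ?case using subspace_0[OF subspace_P] by (simp add: span_zero)
  next
    case (step c x y)
    then obtain d where x: "x \<in> gr g d" by blast
    note xC = gr_C[OF x]
    have yC: "y \<in> C" using step by (simp add: lie_carrier_def)
    have "(ad ?a ^^ (N + 2)) (c *\<^sub>R x + y) = c *\<^sub>R (ad ?a ^^ (N + 2)) x + (ad ?a ^^ (N + 2)) y"
      using a xC yC by (simp add: pow_add pow_scale subspace_scale[OF subspace_C] del: funpow.simps)
    then show ?case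
      using step hom[OF x] xC yC subspace_P subspace_C
      by (simp add: lie_carrier_def[symmetric] subspace_add subspace_scale del: funpow.simps)
  qed
  then show ?thesis ..
qed

text \<open>Box \<open>(i, j + 1)\<close> is the derivative of box \<open>(i, j)\<close> under
  \<open>ad X\<close>, and passing to a derivative doubles the exponent.\<close>

lemma E_pow_in_P:
  assumes N: "\<And>i. i \<in> {1..n} \<Longrightarrow> k i \<le> N"
  shows "(i, j) \<in> boxes n k \<Longrightarrow> u \<in> C \<Longrightarrow> (ad (E (i, j)) ^^ ((N + 2) * 2 ^ j)) u \<in> P"
proof (induction j arbitrary: u)
  case 0
  then show ?case using row_start_pow_in_P[OF _ N] by (simp add: boxes_def del: funpow.simps)
next
  case (Suc j)
  have b: "(i, j) \<in> boxes n k" using Suc.prems(1) by (simp add: boxes_def)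
  have X: "ad X (E (i, j)) = E (i, Suc j)" using brk_X_E[OF b] Suc.prems(1) by simp
  have *: "ad (E b') (ad X (E (i, Suc j))) = 0" if "b' \<in> boxes n k" for b'
    using brk_E_E[OF that] E_C[OF that] by (simp add: brk_X_E[OF Suc.prems(1)] del: fst_conv snd_conv)
  have "(ad (ad X (E (i, j))) ^^ (2 * ((N + 2) * 2 ^ j))) u \<in> P"
  proof (rule pow_in_derivation[OF X_C E_C[OF b] _ _ _ subspace_P])
    show "ad (E (i, j)) (ad X (E (i, j))) = 0"
      unfolding X by (rule brk_E_E[OF b Suc.prems(1)])
    show "ad (E (i, j)) (ad X (ad X (E (i, j)))) = 0"
      unfolding X by (rule *[OF b])
    show "ad (ad X (E (i, j))) (ad X (ad X (E (i, j)))) = 0"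
      unfolding X by (rule *[OF Suc.prems(1)])
  qed (use brk_X_P Suc.IH[OF b] Suc.prems in blast)+
  moreover have "2 * ((N + 2) * 2 ^ j) = (N + 2) * 2 ^ Suc j" by simp
  ultimately show ?case unfolding X by metis
qed

text \<open>One exponent for all boxes: the length of the longest row serves as \<open>N\<close> and
  bounds the position \<open>j\<close> as well.\<close>

definition "K = (Max (k ` {1..n}) + 2) * 2 ^ Max (k ` {1..n})"

lemma E_pow_K_in_P:
  assumes b: "b \<in> boxes n k" and u: "u \<in> C"
  shows "(ad (E b) ^^ K) u \<in> P"
proof -
  obtain i j where ij: "b = (i, j)" by (cases b)
  let ?N = "Max (k ` {1..n})"
  have N: "k i \<le> ?N" if "i \<in> {1..n}" for i using that by simp
  have "j < k i" "i \<in> {1..n}" using b ij by (auto simp: boxes_def)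
  then have "j \<le> ?N" using N[of i] by linarith
  then have "(?N + 2) * 2 ^ j \<le> K" unfolding K_def by (intro mult_le_mono power_increasing) auto
  then obtain r where "K = (?N + 2) * 2 ^ j + r" using le_Suc_ex by blast
  then have "(ad (E b) ^^ K) u = (ad (E b) ^^ ((?N + 2) * 2 ^ j)) ((ad (E b) ^^ r) u)"
    by (simp only: funpow_add o_def)
  then show ?thesis
    using E_pow_in_P[OF N, of i j "(ad (E b) ^^ r) u"] b ij pow_C[OF E_C[OF b] u] by simp
qed

section \<open>Products of box operators\<close>

text \<open>A monomial in the commuting operators of the boxes; \<open>fold\<close> applies the head
  of the list first.\<close>

abbreviation "word bs \<equiv> fold (\<lambda>b. ad (E b)) bs"

lemma word_diff:
  "set bs \<subseteq> boxes n k \<Longrightarrow> v \<in> C \<Longrightarrow> w \<in> C \<Longrightarrow> word bs (v - w) = word bs v - word bs w"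
proof (induction bs arbitrary: v w)
  case (Cons b bs)
  have E: "E b \<in> C" using E_C Cons.prems by simp
  have "ad (E b) (v - w) = ad (E b) v - ad (E b) w"
    using brk_add_right[of "v - w" w "E b"] E Cons.prems subspace_diff[OF subspace_C] by simp
  then show ?case using Cons E by (simp add: brk_C)
qed simp

lemma word_commute:
  "set bs \<subseteq> boxes n k \<Longrightarrow> b \<in> boxes n k \<Longrightarrow> w \<in> C \<Longrightarrow> word bs (ad (E b) w) = ad (E b) (word bs w)"
proof (induction bs arbitrary: w)
  case (Cons c bs)
  have "ad (E c) (ad (E b) w) = ad (E b) (ad (E c) w)"
    using Cons.prems by (intro brk_commute brk_E_E E_C) auto
  then show ?case using Cons by (simp add: brk_C E_C)
qed simp

text \<open>As the operators commute, \<open>m\<close> occurrences of \<open>b\<close> can be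
  collected on the outside, where \<open>E_pow_K_in_P\<close> applies to them.\<close>

lemma word_eq_pow:
  "set bs \<subseteq> boxes n k \<Longrightarrow> b \<in> boxes n k \<Longrightarrow> m \<le> count_list bs b \<Longrightarrow> w \<in> C \<Longrightarrow>
    \<exists>v\<in>C. word bs w = (ad (E b) ^^ m) v"
proof (induction bs arbitrary: m w)
  case Nil
  then show ?case by auto
next
  case (Cons c bs)
  have w: "ad (E c) w \<in> C" using Cons.prems by (simp add: brk_C E_C)
  show ?case
  proof (cases "c = b \<and> 0 < m")
    case True
    then obtain m' where m: "m = Suc m'" by (cases m) auto
    with True Cons.IH[of m' w] Cons.prems obtain v where "v \<in> C" "word bs w = (ad (E b) ^^ m') v"
      by auto
    then show ?thesis using True m Cons.prems by (auto simp: word_commute)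
  next
    case False
    then have "m \<le> count_list bs b" using Cons.prems by auto
    then show ?thesis using Cons.IH[of m "ad (E c) w"] Cons.prems w by simp
  qed
qed

text \<open>Pigeonhole: some box occurs at least \<open>K\<close> times in the word.\<close>

lemma long_word_in_P:
  assumes bs: "set bs \<subseteq> boxes n k" and len: "K * card (boxes n k) < length bs" and w: "w \<in> C"
  shows "word bs w \<in> P"
proof -
  have "\<exists>b\<in>boxes n k. K \<le> count_list bs b"
  proof (rule ccontr)
    assume "\<not> ?thesis"
    then have "sum (count_list bs) (boxes n k) \<le> of_nat (card (boxes n k)) * K"
      by (intro sum_bounded_above) auto
    then show False using sum_count_set[OF bs finite_boxes] len by (simp add: mult.commute)
  qed
  then obtain b where b: "b \<in> boxes n k" "K \<le> count_list bs b" by blast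
  from word_eq_pow[OF bs b w] show ?thesis using E_pow_K_in_P[OF b(1)] by auto
qed

section \<open>The largest submodule inside \<open>P\<close>\<close>

text \<open>The empty word accounts for membership in \<open>P\<close> itself, so this is the
  largest subset of \<open>P\<close> stable under all box operators.\<close>

definition "Kern = {w \<in> C. \<forall>bs. set bs \<subseteq> boxes n k \<longrightarrow> word bs w \<in> P}"

lemma KernD: "w \<in> Kern \<Longrightarrow> w \<in> C" "w \<in> Kern \<Longrightarrow> set bs \<subseteq> boxes n k \<Longrightarrow> word bs w \<in> P"
  by (auto simp: Kern_def)

lemma Kern_E:
  assumes "w \<in> Kern" "b \<in> boxes n k" shows "ad (E b) w \<in> Kern"
proof -
  have "word bs (ad (E b) w) \<in> P" if "set bs \<subseteq> boxes n k" for bs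
    using KernD(2)[OF assms(1), of "b # bs"] assms(2) that by simp
  then show ?thesis using KernD(1)[OF assms(1)] E_C[OF assms(2)] brk_C by (simp add: Kern_def)
qed

text \<open>Moving \<open>X\<close> out of a word leaves corrections in which a letter is replaced
  by its right neighbour or by \<open>0\<close>, so they are again words or zero. What finally
  remains is \<open>ad X\<close> applied to an element of \<open>P\<close>.\<close>

lemma Kern_X:
  assumes "w \<in> Kern" shows "ad X w \<in> Kern"
proof -
  have "word bs (ad X w) \<in> P" if "set bs \<subseteq> boxes n k" for bs
    using that assms
  proof (induction bs arbitrary: w)
    case Nil
    then show ?case using brk_X_P KernD(2)[of w "[]"] by simp
  next
    case (Cons b bs)
    have b: "b \<in> boxes n k" "set bs \<subseteq> boxes n k" using Cons.prems by auto
    note w = KernD(1)[OF Cons.prems(2)]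
    note E = E_C[OF b(1)]
    have XE: "ad X (E b) \<in> C" using X_C E brk_C by blast
    have Ew: "ad X (ad (E b) w) \<in> C" "ad (ad X (E b)) w \<in> C" using X_C E XE w brk_C by blast+
    have "ad (E b) (ad X w) = ad X (ad (E b) w) - ad (ad X (E b)) w"
      using brk_derivation[OF X_C E w] by simp
    then have "word (b # bs) (ad X w) = word bs (ad X (ad (E b) w)) - word bs (ad (ad X (E b)) w)"
      using word_diff[OF b(2) Ew] by simp
    moreover have "word bs (ad X (ad (E b) w)) \<in> P"
      by (rule Cons.IH[OF b(2) Kern_E[OF Cons.prems(2) b(1)]])
    moreover have "word bs (ad (ad X (E b)) w) \<in> P"
    proof (cases "(fst b, Suc (snd b)) \<in> boxes n k")
      case True
      then show ?thesis
        using KernD(2)[OF Kern_E[OF Cons.prems(2) True] b(2)] brk_X_E[OF b(1)] by simp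
    next
      case False
      moreover have "word bs 0 = 0" using word_diff[OF b(2) w w] by simp
      ultimately show ?thesis using brk_X_E[OF b(1)] w subspace_0[OF subspace_P] by simp
    qed
    ultimately show ?case using subspace_diff[OF subspace_P] by simp
  qed
  then show ?thesis using KernD(1)[OF assms] X_C brk_C by (simp add: Kern_def)
qed

lemma Kern_gen: "w \<in> Kern \<Longrightarrow> b \<in> gens n k \<Longrightarrow> ad (\<iota> (bvec b)) w \<in> Kern"
  using Kern_X Kern_E by (auto simp: gens_eq)

lemma neg_in_P:
  assumes "y \<in> lie_carrier T" "\<iota> y \<in> P"
  shows "\<exists>c. y = c *\<^sub>R bvec GX"
proof -
  from assms(2) obtain c where c: "\<iota> y - c *\<^sub>R X \<in> nonneg_part g" unfolding P_iff by blast
  note GX = bvec_carrier[OF gens_intros(1)]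
  have cGX: "c *\<^sub>R bvec GX \<in> lie_carrier T" using GX subspace_scale[OF subspace_carrier] by blast
  have eq: "\<iota> y - c *\<^sub>R X = \<iota> (y - c *\<^sub>R bvec GX)"
    using assms(1) GX cGX by (simp add: \<iota>_diff \<iota>_scale)
  then have "\<iota> y - c *\<^sub>R X = 0"
    using nonneg_neg_disjoint[OF c] \<iota>_neg_part[OF subspace_diff[OF subspace_carrier assms(1) cGX]] by simp
  then have "\<iota> y = \<iota> (c *\<^sub>R bvec GX)" using \<iota>_scale[OF GX] by simp
  then show ?thesis using \<iota>_inj[OF assms(1) cGX] by blast
qed

text \<open>Such an element is a multiple of \<open>X\<close>. Its bracket with the first box of row
  \<open>1\<close> is, up to sign, the same multiple of the second box, and in \<open>P\<close> that
  multiple can only be zero.\<close>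

lemma Kern_neg:
  assumes "u \<in> gr g i" "i < 0" "u \<in> Kern"
  shows "u = 0"
proof -
  obtain y where y: "y \<in> lie_carrier T" "u = \<iota> y"
    using assms(1,2) gr_neg gr_carrier_tableau by blast
  have "u \<in> P" using KernD(2)[OF assms(3), of "[]"] by simp
  then obtain c where c: "y = c *\<^sub>R bvec GX" using neg_in_P y by blast
  have b: "(1, 0) \<in> boxes n k" "(1, Suc 0) \<in> boxes n k" using l[of 1] n by (auto simp: boxes_def)
  have u: "u = c *\<^sub>R X" using y c \<iota>_scale bvec_carrier gens_intros(1) by blast
  note GE = bvec_carrier[OF gens_intros(2)[OF b(2)], simplified]
  have cGE: "c *\<^sub>R bvec (GE 1 (Suc 0)) \<in> lie_carrier T" using GE subspace_scale[OF subspace_carrier] by simp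
  have "ad (E (1, 0)) u = c *\<^sub>R ad (E (1, 0)) X"
    unfolding u using E_C[OF b(1)] X_C by (simp add: brk_scale_right)
  also have "ad (E (1, 0)) X = - E (1, Suc 0)"
    using brk_swap[OF E_C[OF b(1)] X_C] brk_X_E[OF b(1)] b(2) by simp
  finally have "\<iota> (c *\<^sub>R bvec (GE 1 (Suc 0))) = - ad (E (1, 0)) u" using \<iota>_scale[OF GE] by simp
  moreover have "ad (E (1, 0)) u \<in> P" using KernD(2)[OF assms(3), of "[(1, 0)]"] b by simp
  ultimately have "\<iota> (c *\<^sub>R bvec (GE 1 (Suc 0))) \<in> P" using subspace_neg[OF subspace_P] by simp
  then obtain c' where "c *\<^sub>R bvec (GE 1 (Suc 0)) = c' *\<^sub>R bvec GX" using neg_in_P[OF cGE] by blast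
  from arg_cong[OF this, of "\<lambda>p. Poly_Mapping.lookup p (GE 1 (Suc 0))"]
  have "c = 0" by (simp add: lookup_scaleR_pm lookup_single when_def)
  then show ?thesis by (simp add: u)
qed

text \<open>Brackets with basis elements of \<open>m\<close> stay in \<open>Kern\<close> and lower
  the degree, so they vanish by induction, and non-degeneracy applies.\<close>

lemma Kern_gr: "u \<in> gr g i \<Longrightarrow> u \<in> Kern \<Longrightarrow> u = 0"
\<comment> \<open>The measure is \<open>0\<close> in all negative degrees, which are settled
  directly, and from degree \<open>0\<close> on it grows with the degree.\<close>
proof (induction "nat (i + 1)" arbitrary: i u rule: less_induct)
  case less
  show ?case
  proof (cases "i < 0")
    case True
    then show ?thesis using Kern_neg less.prems by blast
  next
    case False
    note u = gr_C[OF less.prems(1)]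
    have gen: "ad u (\<iota> (bvec b)) = 0" if b: "b \<in> gens n k" for b
    proof -
      have "ad (\<iota> (bvec b)) u \<in> gr g (gen_deg n l b + i)"
        by (rule brk_gr[OF \<iota>_gr[OF bvec_gr[OF b]] less.prems(1)])
      then have "ad (\<iota> (bvec b)) u = 0"
        using less.hyps[of "gen_deg n l b + i"] Kern_gen[OF less.prems(2) b] gen_deg_neg[of n l b] False
        by simp
      then show ?thesis using brk_swap[OF u gr_C[OF \<iota>_gr[OF bvec_gr[OF b]]]] by simp
    qed
    show ?thesis
    proof (rule nondegenerate[OF _ less.prems(1)])
      fix x assume "x \<in> lie_carrier T"
      then have "ad u (\<iota> x) \<in> {0}"
        using gen gr_C[OF \<iota>_gr[OF bvec_gr]]
        by (intro brk_span_right[OF u _ _ _ \<iota>_span]) (auto simp: subspace_def)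
      then show "ad u (\<iota> x) = 0" by simp
    qed (use False in simp)
  qed
qed

section \<open>Vanishing in large degrees and finite dimension\<close>

text \<open>Each letter lowers the degree by at most \<open>D\<close>, so a word that is short in
  relation to the degree cannot reach negative degrees.\<close>

lemma word_gr:
  assumes D: "\<And>b. b \<in> boxes n k \<Longrightarrow> column n l b \<le> D"
  shows "set bs \<subseteq> boxes n k \<Longrightarrow> u \<in> gr g i \<Longrightarrow> int D * int (length bs) \<le> i \<Longrightarrow> \<exists>j\<ge>0. word bs u \<in> gr g j"
proof (induction bs arbitrary: u i)
  case Nil
  then show ?case by auto
next
  case (Cons b bs)
  have b: "b \<in> boxes n k" using Cons.prems by simp
  have "ad (E b) u \<in> gr g (- int (column n l b) + i)" by (rule brk_gr[OF E_gr[OF b] Cons.prems(2)])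
  moreover have "int D * int (length bs) \<le> - int (column n l b) + i"
    using Cons.prems(3) D[OF b] by (simp add: algebra_simps)
  ultimately show ?case using Cons.IH[of "ad (E b) u"] Cons.prems(1) by simp
qed

lemma gr_eventually_zero: "\<exists>B. \<forall>i\<ge>B. gr g i = {0}"
proof -
  define D where "D = Max (column n l ` boxes n k)"
  have D: "column n l b \<le> D" if "b \<in> boxes n k" for b
    using that finite_boxes by (simp add: D_def)
  \<comment> \<open>\<open>B\<close> bounds the drop in degree caused by a word too short for
    \<open>long_word_in_P\<close>.\<close>
  define B where "B = int D * int (K * card (boxes n k))"
  have "u = 0" if i: "B \<le> i" and u: "u \<in> gr g i" for i u
  proof (rule Kern_gr[OF u])
    have "word bs u \<in> P" if bs: "set bs \<subseteq> boxes n k" for bs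
    proof (cases "K * card (boxes n k) < length bs")
      case True
      then show ?thesis using long_word_in_P[OF bs] gr_C[OF u] by blast
    next
      case False
      then have "int D * int (length bs) \<le> B"
        unfolding B_def by (intro mult_left_mono) linarith+
      then show ?thesis using word_gr[OF D bs u] i P_gr by force
    qed
    then show "u \<in> Kern" using gr_C[OF u] by (simp add: Kern_def)
  qed
  then have "\<forall>i\<ge>B. gr g i = {0}" using subspace_0[OF subspace_gr] by blast
  then show ?thesis ..
qed

text \<open>In degree \<open>i \<ge> 0\<close> an element is determined by its brackets with the
  finitely many basis elements of \<open>m\<close>, and these brackets lie in lower degrees.\<close>

lemma gr_finite_span: "\<exists>G. finite G \<and> gr g i = span G"
proof (induction "nat (i + 1)" arbitrary: i rule: less_induct)
  case less
  show ?case
  proof (cases "i < 0")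
    case True
    \<comment> \<open>With the identity as the only map, the criterion for jointly injective maps
      shows that a subspace of a finitely generated space is finitely generated.\<close>
    have "\<exists>B. finite B \<and> id ` gr g i \<subseteq> span B"
      using gr_neg[OF True] \<iota>_span[OF gr_carrier_tableau] finite_gens
      by (intro exI[of _ "(\<lambda>b. \<iota> (bvec b)) ` gens n k"]) auto
    then show ?thesis
      using finite_span_if_jointly_injective[of "{()}" "gr g i" "\<lambda>_. id"] subspace_gr by simp
  next
    case False
    show ?thesis
    proof (rule finite_span_if_jointly_injective[OF finite_gens subspace_gr, where \<phi> = "\<lambda>b. ad (\<iota> (bvec b))"])
      fix b assume b: "b \<in> gens n k"
      note bg = \<iota>_gr[OF bvec_gr[OF b]]
      note bC = gr_C[OF bg]
      show "ad (\<iota> (bvec b)) (x + y) = ad (\<iota> (bvec b)) x + ad (\<iota> (bvec b)) y"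
        if "x \<in> gr g i" "y \<in> gr g i" for x y
        using brk_add_right that[THEN gr_C] bC by blast
      show "ad (\<iota> (bvec b)) (r *\<^sub>R x) = r *\<^sub>R ad (\<iota> (bvec b)) x" if "x \<in> gr g i" for r x
        using brk_scale_right gr_C[OF that] bC by blast
      obtain G where G: "finite G" "gr g (gen_deg n l b + i) = span G"
        using less.hyps[of "gen_deg n l b + i"] gen_deg_neg[of n l b] False by auto
      then show "\<exists>B. finite B \<and> ad (\<iota> (bvec b)) ` gr g i \<subseteq> span B"
        using brk_gr[OF bg] by (intro exI[of _ G]) auto
    next
      fix u assume u: "u \<in> gr g i" "\<And>b. b \<in> gens n k \<Longrightarrow> ad (\<iota> (bvec b)) u = 0"
      have gen: "ad u (\<iota> (bvec b)) = 0" if b: "b \<in> gens n k" for b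
        using brk_swap[OF gr_C[OF u(1)] gr_C[OF \<iota>_gr[OF bvec_gr[OF b]]]] u(2)[OF b] by simp
      show "u = 0"
      proof (rule nondegenerate[OF _ u(1)])
        fix x assume "x \<in> lie_carrier T"
        then have "ad u (\<iota> x) \<in> {0}"
          using gen gr_C[OF \<iota>_gr[OF bvec_gr]]
          by (intro brk_span_right[OF gr_C[OF u(1)] _ _ _ \<iota>_span]) (auto simp: subspace_def)
        then show "ad u (\<iota> x) = 0" by simp
      qed (use False in simp)
    qed
  qed
qed

theorem finite_dimensional_extension: "finite_dimensional g"
proof -
  obtain B where B: "\<And>i. B \<le> i \<Longrightarrow> gr g i = {0}" using gr_eventually_zero by blast
  obtain G where G: "\<And>i. finite (G i)" "\<And>i. gr g i = span (G i)" using gr_finite_span by metis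
  \<comment> \<open>The image of the basis of \<open>m\<close> generates all negative degrees at
    once; only the finitely many degrees from \<open>0\<close> to \<open>B - 1\<close> need
    generators of their own.\<close>
  define H where "H = (\<lambda>b. \<iota> (bvec b)) ` gens n k \<union> (\<Union>i\<in>{0..<B}. G i)"
  have "gr g i \<subseteq> span H" for i
  proof -
    consider "i < 0" | "0 \<le> i" "i < B" | "B \<le> i" by linarith
    then show ?thesis
    proof cases
      case 1
      have "span ((\<lambda>b. \<iota> (bvec b)) ` gens n k) \<subseteq> span H"
        by (rule span_mono) (simp add: H_def)
      then show ?thesis
        unfolding gr_neg[OF 1] using \<iota>_span[OF gr_carrier_tableau] by fast
    next
      case 2
      then show ?thesis unfolding G(2) by (intro span_mono) (auto simp: H_def)
    next
      case 3
      then show ?thesis using B by (simp add: span_zero)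
    qed
  qed
  then have "C \<subseteq> span H" unfolding lie_carrier_def by (intro span_minimal) auto
  moreover have "H \<subseteq> C"
    unfolding H_def using gr_C[OF \<iota>_gr[OF bvec_gr]] G(2) span_base gr_C by blast
  then have "span H \<subseteq> C" using subspace_C by (rule span_minimal)
  moreover have "finite H" unfolding H_def using finite_gens G(1) by simp
  ultimately show ?thesis unfolding finite_dimensional_def by blast
qed

end

theorem proposition5p3:
  fixes n :: nat and k l :: "nat \<Rightarrow> nat"
    and g :: "'g::real_vector graded_lie" and \<iota> :: "(gen \<Rightarrow>\<^sub>0 real) \<Rightarrow> 'g"
  assumes "n \<ge> 2"
    and "\<And>i. i \<in> {1..n} \<Longrightarrow> 2 \<le> l i \<and> l i \<le> k i"
    and "is_generalized_prolongation (tableau_algebra n k l) tableau_e (tableau_f n k l) g \<iota>"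
  shows "finite_dimensional g"
proof -
  interpret tableau_extension n k l g \<iota>
    by (rule tableau_extension.intro)
      (use assms in \<open>auto simp only: is_generalized_prolongation_def\<close>)
  show ?thesis by (rule finite_dimensional_extension)
qed

end
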